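(* Let $W(t)$, $t\in\mathbb{R}$, be a family of operators $W(t):H\to L^2(X)$, where $H$ is a Hilbert space and $(X,dx)$ is a measure space, and let $h>0$ be a parameter (on which $W(t)$ may depend). Let $\mu_\infty,\sigma_\infty,\mu_2,\sigma_2$ be real numbers with $\sigma_\infty\neq\sigma_2$. Assume that $W(t)$ satisfies the estimates: (i) for all $t,s\in\mathbb{R}$ and $f\in L^1(X)$, $$\|W(t)W^{\star}(s)f\|_{L^\infty(X)}\lesssim h^{-\mu_\infty}(h+|t-s|)^{-\sigma_\infty}\|f\|_{L^1(X)};$$ (ii) for all $t,s\in\mathbb{R}$ and $f\in L^2(X)$, $$\|W(t)W^{\star}(s)f\|_{L^2(X)}\lesssim h^{-\mu_2}(h+|t-s|)^{-\sigma_2}\|f\|_{L^2(X)}.$$ Then, for all $f\in H$, $$\left(\int_{\mathbb{R}}\|W(t)f\|_{L^p(X)}^r\,dt\right)^{1/r}\lesssim h^{-\left(\frac{\mu_\infty-\mu_2}{r(\sigma_\infty-\sigma_2)}+\frac{\sigma_\infty\mu_2-\sigma_2\mu_\infty}{2(\sigma_\infty-\sigma_2)}\right)}\|f\|_{H}$$ for all pairs $(r,p)$ with $2<r\le\infty$, $2\le p\le\infty$ such that $$\frac{1}{r}+\frac{1}{p}(\sigma_\infty-\sigma_2)=\frac{\sigma_\infty}{2}.$$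
   Context: $W^\star(s):L^2(X)\to H$ is the adjoint of $W(s)$. Estimate (i) is understood on $L^1(X)\cap L^2(X)$, where $W(t)W^\star(s)f$ is defined, and then by extension. $A\lesssim B$ means $A\le CB$ with $C$ independent of $h,t,s,f$ (in the conclusion $C$ may depend on $r,p$, the exponents $\mu_\infty,\sigma_\infty,\mu_2,\sigma_2$ and the constants in (i), (ii)). For $r=\infty$ the left side of the conclusion is the essential supremum over $t$. The operators $W(t)$ are linear and depend on $t$ measurably, so that the time integrals make sense. *)

theory Defs
  imports "HOL-Analysis.Analysis" "HOL-Probability.Essential_Supremum"
begin

text \<open>
  Complex Hilbert spaces. The inner product is linear in its first argument; the last axiom
  says both that it is positive definite and that it induces the norm, with respect to which
  the space is complete (class \<^class>\<open>banach\<close>).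
\<close>

class complex_hilbert_space = banach +
  fixes scaleC :: "complex \<Rightarrow> 'a \<Rightarrow> 'a"
    and cinner :: "'a \<Rightarrow> 'a \<Rightarrow> complex"
  assumes scaleC_add_right: "scaleC c (x + y) = scaleC c x + scaleC c y"
    and scaleC_add_left: "scaleC (c + d) x = scaleC c x + scaleC d x"
    and scaleC_scaleC: "scaleC c (scaleC d x) = scaleC (c * d) x"
    and scaleC_of_real: "scaleC (complex_of_real a) x = scaleR a x"
    and cinner_commute: "cinner x y = cnj (cinner y x)"
    and cinner_add_left: "cinner (x + y) z = cinner x z + cinner y z"
    and cinner_scaleC_left: "cinner (scaleC c x) y = c * cinner x y"
    and cinner_self: "cinner x x = complex_of_real ((norm x)\<^sup>2)"

instantiation complex :: complex_hilbert_space
begin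

definition scaleC_complex :: "complex \<Rightarrow> complex \<Rightarrow> complex"
  where "scaleC_complex c z = c * z"

definition cinner_complex :: "complex \<Rightarrow> complex \<Rightarrow> complex"
  where "cinner_complex z w = z * cnj w"

instance
proof
qed (simp_all add: scaleC_complex_def cinner_complex_def algebra_simps
       scaleR_conv_of_real flip: complex_norm_square)

end

text \<open>Powers of extended nonnegative reals; only used for exponents \<open>a > 0\<close>.\<close>

definition ennreal_powr :: "ennreal \<Rightarrow> real \<Rightarrow> ennreal" where
  "ennreal_powr x a = (if x = \<infinity> then \<infinity> else ennreal (enn2real x powr a))"

text \<open>
  The \<open>L\<^sup>p\<close> norm for \<open>1 \<le> p \<le> \<infinity>\<close>, first for \<open>[0,\<infinity>]\<close>-valued functions, so that it can be
  iterated to form mixed norms.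
\<close>

definition ennreal_Lp_norm :: "'a measure \<Rightarrow> ennreal \<Rightarrow> ('a \<Rightarrow> ennreal) \<Rightarrow> ennreal" where
  "ennreal_Lp_norm M p F =
     (if p = \<infinity> then esssup M F
      else ennreal_powr (\<integral>\<^sup>+x. ennreal_powr (F x) (enn2real p) \<partial>M) (1 / enn2real p))"

definition Lp_norm :: "'a measure \<Rightarrow> ennreal \<Rightarrow> ('a \<Rightarrow> complex) \<Rightarrow> ennreal" where
  "Lp_norm M p f = ennreal_Lp_norm M p (\<lambda>x. ennreal (cmod (f x)))"

text \<open>Elements of \<open>L\<^sup>p\<close> are represented by functions; equality in \<open>L\<^sup>p\<close> is equality a.e.\<close>

definition Lp_space :: "'a measure \<Rightarrow> ennreal \<Rightarrow> ('a \<Rightarrow> complex) set" where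
  "Lp_space M p = {f \<in> borel_measurable M. Lp_norm M p f < \<infinity>}"

definition linear_into_L2 ::
    "'x measure \<Rightarrow> ('h::complex_hilbert_space \<Rightarrow> 'x \<Rightarrow> complex) \<Rightarrow> bool" where
  "linear_into_L2 M A \<longleftrightarrow>
     (\<forall>f. A f \<in> Lp_space M 2) \<and>
     (\<forall>f g. AE x in M. A (f + g) x = A f x + A g x) \<and>
     (\<forall>c f. AE x in M. A (scaleC c f) x = c * A f x)"

text \<open>
  \<open>B : L\<^sup>2 \<rightarrow> H\<close> is the Hilbert space adjoint of \<open>A : H \<rightarrow> L\<^sup>2\<close>. The values of \<open>B\<close> outside \<open>L\<^sup>2\<close> are
  irrelevant; on \<open>L\<^sup>2\<close> the condition determines \<open>B\<close>. A linear \<open>A\<close> has such an everywhere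
  defined adjoint if and only if it is bounded, hence boundedness of \<open>A\<close> is not a separate
  assumption.
\<close>

definition is_adjoint_L2 ::
    "'x measure \<Rightarrow> ('h::complex_hilbert_space \<Rightarrow> 'x \<Rightarrow> complex) \<Rightarrow> (('x \<Rightarrow> complex) \<Rightarrow> 'h) \<Rightarrow> bool"
  where
  "is_adjoint_L2 M A B \<longleftrightarrow>
     (\<forall>f. \<forall>g\<in>Lp_space M 2. (\<integral>x. A f x * cnj (g x) \<partial>M) = cinner f (B g))"

text \<open>
  Strong (Bochner) measurability of \<open>u : \<real> \<rightarrow> L\<^sup>2\<close>: almost everywhere, \<open>u\<close> is the limit in \<open>L\<^sup>2\<close>
  of a sequence of simple functions with values in \<open>L\<^sup>2\<close>.
\<close>

definition strongly_measurable_L2 :: "'x measure \<Rightarrow> (real \<Rightarrow> 'x \<Rightarrow> complex) \<Rightarrow> bool" where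
  "strongly_measurable_L2 M u \<longleftrightarrow>
     (\<exists>s. (\<forall>n. simple_function lebesgue (s n)) \<and>
          (\<forall>n t. s n t \<in> Lp_space M 2) \<and>
          (AE t in lebesgue. (\<lambda>n. Lp_norm M 2 (\<lambda>x. s n t x - u t x)) \<longlonglongrightarrow> 0))"

end

theory Submission
  imports Defs "HOL-Complex_Analysis.Conformal_Mappings" "HOL-Real_Asymp.Real_Asymp"
begin

text \<open>
  Interpolating (i) and (ii) with \<open>\<theta> = 2/p\<close> bounds \<open>W(t) W\<^sup>*(s)\<close> from \<open>L\<^sup>p\<^sup>'\<close> to \<open>L\<^sup>p\<close> by a power of \<open>h\<close>
  times \<open>(h + |t - s|)\<^sup>-\<^sup>2\<^sup>/\<^sup>r\<close>; this exponent is what the admissibility condition says. For \<open>r = \<infinity>\<close>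
  the case \<open>s = t\<close> is enough. For \<open>r < \<infinity>\<close> the \<open>T T\<^sup>*\<close> argument reduces the claim to the diagonal
  Hardy-Littlewood-Sobolev inequality for the kernel \<open>|t - s|\<^sup>-\<^sup>2\<^sup>/\<^sup>r\<close>. By symmetry that integral may be
  restricted to \<open>w(t) \<le> w(s)\<close>, where the inner integral is controlled by a power of \<open>w(s)\<close>. The norm of
  \<open>W(t) f\<close> is attained as a supremum over countably many simple functions, so only simple test
  functions enter, and interpolation is needed for finite matrices only.
\<close>

section \<open>Complex Hilbert spaces\<close>

text \<open>The value of \<theta> is dictated by duality: the test functions lie in the unit ball of
  L^q with q dual to p, and interpolating between L^1 at \<theta> = 0 and L^2 at \<theta> = 1 needs
  1/q = 1 - \<theta>/2. The exponent of 1/h in the conclusion is half of (1 - \<theta>) \<mu>_inf +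
  \<theta> \<mu>_2, because the duality argument returns the square root of the operator bound. The
  shift by h keeps the bound finite on the diagonal s = t, which makes every vector integral exist
  for fixed h; afterwards h + |t - s| is bounded below by |t - s|, so that the constant is free of
  h. Since r > 2, the kernel |t - s| to the power -2/r is locally integrable. Measurability shapes
  the rest. Measurability of \<open>W t f\<close> in t is given for each fixed f, so the double
  integral of inner products cannot be treated by Tonelli directly: it is kept iterated, and Tonelli
  is applied to a scalar majorant. The space X is an arbitrary measure space; converse Hoelder works
  there because an L^2 function lives on countably many sets of finite measure.\<close>

lemma cinner_add_right:
  "cinner x (y + z) = cinner x y + cinner x (z::'h::complex_hilbert_space)"
  by (metis cinner_add_left cinner_commute complex_cnj_add)

lemma cinner_scaleC_right:
  "cinner x (scaleC c y) = cnj c * cinner x (y::'h::complex_hilbert_space)"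
  by (metis cinner_commute cinner_scaleC_left complex_cnj_mult)

lemma cinner_scaleR_left:
  "cinner (a *\<^sub>R x) y = of_real a * cinner x (y::'h::complex_hilbert_space)"
  by (metis cinner_scaleC_left scaleC_of_real)

lemma cinner_scaleR_right:
  "cinner x (a *\<^sub>R y) = of_real a * cinner x (y::'h::complex_hilbert_space)"
  by (metis cinner_scaleC_right scaleC_of_real complex_cnj_complex_of_real)

lemma cinner_minus_right: "cinner x (- y) = - cinner x (y::'h::complex_hilbert_space)"
  using cinner_scaleR_right[of x "-1" y] by simp

lemma cinner_zero_left [simp]: "cinner 0 (y::'h::complex_hilbert_space) = 0"
  using cinner_scaleR_left[of 0 y y] by simp

lemma cinner_zero_right [simp]: "cinner (y::'h::complex_hilbert_space) 0 = 0"
  using cinner_scaleR_right[of y 0 y] by simp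

lemma cinner_eqI:
  assumes "\<And>f. cinner f x = cinner f (y::'h::complex_hilbert_space)"
  shows "x = y"
proof -
  have "cinner (x - y) (x - y) = 0"
    using assms[of "x - y"] cinner_add_right[of "x - y" x "- y"]
    by (simp add: cinner_minus_right)
  then show ?thesis by (simp add: cinner_self)
qed

lemma norm_add_sq:
  "(norm (x + y))\<^sup>2 = (norm x)\<^sup>2 + 2 * Re (cinner x y) + (norm (y::'h::complex_hilbert_space))\<^sup>2"
proof -
  have "complex_of_real ((norm (x + y))\<^sup>2) = cinner (x + y) (x + y)"
    by (simp add: cinner_self)
  also have "\<dots> = cinner x x + cinner y y + (cinner x y + cnj (cinner x y))"
    using cinner_commute[of y x] by (simp add: cinner_add_left cinner_add_right)
  also have "\<dots> = complex_of_real ((norm x)\<^sup>2 + 2 * Re (cinner x y) + (norm y)\<^sup>2)"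
    by (simp add: cinner_self complex_add_cnj)
  finally show ?thesis using of_real_eq_iff by blast
qed

lemma parallelogram:
  "(norm (x - y))\<^sup>2 = 2 * (norm x)\<^sup>2 + 2 * (norm y)\<^sup>2 - (norm (x + (y::'h::complex_hilbert_space)))\<^sup>2"
  using norm_add_sq[of x y] norm_add_sq[of x "- y"] by (simp add: cinner_minus_right)

text \<open>This is the first-variation test used at a minimum: a parabola through the origin that
  never goes below zero has slope zero there.\<close>

lemma quadratic_nonneg_imp_zero:
  fixes a b :: real
  assumes "\<And>e. 0 \<le> 2 * e * a + e\<^sup>2 * b" "0 \<le> b"
  shows "a = 0"
proof (rule ccontr)
  assume "a \<noteq> 0"
  \<comment> \<open>The vertex of the parabola is at \<open>- a / b\<close>; dividing by
    \<open>b + 1\<close> instead also covers b = 0 and still gives a negative value.\<close>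
  have "0 \<le> 2 * (- a / (b + 1)) * a + (- a / (b + 1))\<^sup>2 * b" by (rule assms)
  also have "\<dots> = a\<^sup>2 * (- b - 2) / (b + 1)\<^sup>2"
    using assms(2) by (simp add: divide_simps power2_eq_square) (simp add: algebra_simps)
  finally have "0 \<le> a\<^sup>2 * (- b - 2) / (b + 1)\<^sup>2" .
  moreover have "a\<^sup>2 * (- b - 2) / (b + 1)\<^sup>2 < 0"
    using assms(2) \<open>a \<noteq> 0\<close> by (intro divide_neg_pos mult_pos_neg) auto
  ultimately show False by simp
qed

text \<open>Cauchy-Schwarz comes from the triangle inequality, which the norm has as part of the
  class: squaring it bounds the real part of the inner product, and a phase turns the modulus into a
  real part.\<close>

lemma norm_cinner_le:
  "cmod (cinner x y) \<le> norm x * norm (y::'h::complex_hilbert_space)"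
proof -
  have re: "Re (cinner x y) \<le> norm x * norm y" for x y :: 'h
  proof -
    have "(norm (x + y))\<^sup>2 \<le> (norm x + norm y)\<^sup>2" by (intro power_mono norm_triangle_ineq) auto
    then show ?thesis unfolding norm_add_sq by (simp add: power2_sum)
  qed
  \<comment> \<open>\<open>sgn 0 = 0\<close>, so c is a unimodular phase or zero; this is why only
    \<open>cmod c \<le> 1\<close> is recorded.\<close>
  define c where "c = cnj (sgn (cinner x y))"
  have c: "c * cinner x y = of_real (cmod (cinner x y))"
    unfolding c_def by (cases "cinner x y = 0")
      (auto simp: sgn_eq complex_norm_square[symmetric] power2_eq_square divide_simps mult.commute)
  have nc: "cmod c \<le> 1" by (simp add: c_def norm_sgn)
  have "complex_of_real ((norm (scaleC c x))\<^sup>2) = (c * cnj c) * cinner x x"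
    unfolding cinner_self[symmetric] by (simp add: cinner_scaleC_left cinner_scaleC_right mult_ac)
  also have "\<dots> = complex_of_real ((cmod c * norm x)\<^sup>2)"
    by (simp add: cinner_self complex_norm_square[symmetric] power_mult_distrib del: of_real_power)
  finally have "(norm (scaleC c x))\<^sup>2 = (cmod c * norm x)\<^sup>2" using of_real_eq_iff by blast
  then have n: "norm (scaleC c x) = cmod c * norm x" by (simp add: power2_eq_iff_nonneg)
  have "cmod (cinner x y) = Re (cinner (scaleC c x) y)" by (simp add: cinner_scaleC_left c)
  also have "\<dots> \<le> cmod c * norm x * norm y" using re[of "scaleC c x" y] by (simp add: n)
  also have "\<dots> \<le> 1 * norm x * norm y" using nc by (intro mult_right_mono) auto
  finally show ?thesis by simp
qed

text \<open>The representing vector is found by the direct method: \<open>J\<close> is minimised,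
  the parallelogram law makes minimising sequences Cauchy, and the vanishing first variation at the
  minimum is the representation. A complex functional is later recovered from its real part.\<close>

lemma riesz_real:
  fixes l :: "'h::complex_hilbert_space \<Rightarrow> real"
  assumes add: "\<And>x y. l (x + y) = l x + l y" and scale: "\<And>a x. l (a *\<^sub>R x) = a * l x"
    and bound: "\<And>x. \<bar>l x\<bar> \<le> b * norm x"
  shows "\<exists>F. \<forall>x. l x = Re (cinner x F)"
proof -
  \<comment> \<open>If \<open>l x = Re (cinner x F)\<close>, this is the squared distance from x to
    F minus the squared norm of F, so its minimiser is the wanted F.\<close>
  define J where "J x = (norm x)\<^sup>2 - 2 * l x" for x
  define m where "m = Inf (range J)"
  have Jlow: "- b\<^sup>2 \<le> J x" for x
  proof -
    have "0 \<le> (norm x - b)\<^sup>2" by simp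
    then show ?thesis using bound[of x] by (simp add: J_def power2_eq_square algebra_simps)
  qed
  have bdd: "bdd_below (range J)" using Jlow by (auto intro!: bdd_belowI[of _ "- b\<^sup>2"])
  have mJ: "m \<le> J x" for x unfolding m_def by (intro cInf_lower bdd) auto
  have "\<exists>x. J x < m + 1 / (real n + 1)" for n
    using cInf_lessD[of "range J" "m + 1 / (real n + 1)"] by (auto simp: m_def)
  then obtain X where X: "\<And>n. J (X n) < m + 1 / (real n + 1)" by metis
  \<comment> \<open>The midpoint of x and y has \<open>J\<close> at least m, and the parallelogram
    law turns this into a bound on their distance.\<close>
  have par: "(norm (x - y))\<^sup>2 \<le> 2 * (J x - m) + 2 * (J y - m)" for x y
  proof -
    have "J ((1/2) *\<^sub>R (x + y)) = (norm (x + y))\<^sup>2 / 4 - (l x + l y)"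
      unfolding J_def scale norm_scaleR by (simp add: add power_mult_distrib power2_eq_square add_divide_distrib)
    with mJ[of "(1/2) *\<^sub>R (x + y)"] show ?thesis
      unfolding parallelogram by (simp add: J_def)
  qed
  have "Cauchy X"
  proof (rule CauchyI)
    fix e :: real assume "0 < e"
    obtain N where N: "4 * (1 / (real N + 1)) < e\<^sup>2"
    proof -
      obtain N where "4 / e\<^sup>2 < real N" using reals_Archimedean2 by blast
      then have "4 / e\<^sup>2 < real N + 1" by simp
      then show ?thesis using \<open>0 < e\<close> by (intro that[of N]) (simp add: divide_simps mult.commute)
    qed
    have "norm (X i - X j) < e" if "i \<ge> N" "j \<ge> N" for i j
    proof -
      define d where "d = 1 / (real N + 1)"
      have "J (X k) < m + d" if "k \<ge> N" for k
      proof -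
        have "1 / (real k + 1) \<le> d" unfolding d_def using that by (intro divide_left_mono) auto
        then show ?thesis using X[of k] by linarith
      qed
      then have "J (X i) < m + d" "J (X j) < m + d" using that by auto
      moreover have "2 * (a - m) + 2 * (b - m) < 4 * d" if "a < m + d" "b < m + d" for a b
        using that by (smt (verit))
      ultimately have "2 * (J (X i) - m) + 2 * (J (X j) - m) < 4 * d" by blast
      then have "(norm (X i - X j))\<^sup>2 < e\<^sup>2"
        using N[folded d_def] by (rule le_less_trans[OF par less_trans])
      then show ?thesis by (rule power2_less_imp_less) (use \<open>0 < e\<close> in simp)
    qed
    then show "\<exists>M. \<forall>m\<ge>M. \<forall>n\<ge>M. norm (X m - X n) < e" by blast
  qed
  then obtain F where F: "X \<longlonglongrightarrow> F" using Cauchy_convergent convergent_def by blast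
  have ldiff: "l (x - y) = l x - l y" for x y using add[of "x - y" y] by simp
  have "norm (l (X n) - l F) \<le> b * norm (X n - F)" for n
    using bound[of "X n - F"] by (simp add: ldiff)
  then have "\<forall>\<^sub>F n in sequentially. norm (l (X n) - l F) \<le> b * norm (X n - F)" by simp
  moreover have "(\<lambda>n. b * norm (X n - F)) \<longlonglongrightarrow> 0"
    using F by (intro tendsto_mult_right_zero tendsto_norm_zero) (simp add: LIM_zero)
  ultimately have "(\<lambda>n. l (X n) - l F) \<longlonglongrightarrow> 0" by (rule Lim_null_comparison)
  then have "(\<lambda>n. l (X n)) \<longlonglongrightarrow> l F" by (rule LIM_zero_cancel)
  then have "(\<lambda>n. J (X n)) \<longlonglongrightarrow> J F" unfolding J_def by (intro tendsto_intros F)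
  moreover have "(\<lambda>n. m + 1 / (real n + 1)) \<longlonglongrightarrow> m + 0"
    by (intro tendsto_intros) (use LIMSEQ_inverse_real_of_nat in \<open>simp add: inverse_eq_divide add.commute\<close>)
  ultimately have "J F \<le> m + 0" by (rule LIMSEQ_le) (use X less_imp_le in blast)
  then have JF: "J F \<le> J x" for x using mJ[of x] by simp
  have "l x = Re (cinner x F)" for x
  proof -
    \<comment> \<open>F minimises \<open>J\<close>; comparing it with
      \<open>F + e *\<^sub>R x\<close> for all real e leaves a nonnegative quadratic in e without
      constant term.\<close>
    have "Re (cinner F x) - l x = 0"
    proof (rule quadratic_nonneg_imp_zero[where b = "(norm x)\<^sup>2"])
      fix e :: real
      show "0 \<le> 2 * e * (Re (cinner F x) - l x) + e\<^sup>2 * (norm x)\<^sup>2"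
        using JF[of "F + e *\<^sub>R x"] unfolding J_def norm_add_sq
        by (simp add: add scale cinner_scaleR_right power_mult_distrib algebra_simps)
    qed simp
    then show ?thesis using cinner_commute[of x F] by simp
  qed
  then show ?thesis by blast
qed

lemma norm_cinner_commute: "cmod (cinner x y) = cmod (cinner y (x::'h::complex_hilbert_space))"
  by (metis cinner_commute complex_mod_cnj)

text \<open>The weak integral of \<open>b\<close> is the Riesz representative \<open>F\<close>; iterating
  the representation bounds its norm without any joint measurability of \<open>cinner (b t) (b s)\<close>.\<close>

lemma weak_integral_bound:
  fixes b :: "'t \<Rightarrow> 'h::complex_hilbert_space"
  assumes int: "\<And>g. integrable N (\<lambda>t. cinner g (b t))"
    and bdd: "\<And>g. cmod (\<integral>t. cinner g (b t) \<partial>N) \<le> \<beta> * norm g"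
    and D: "(\<integral>\<^sup>+t. (\<integral>\<^sup>+s. ennreal (cmod (cinner (b t) (b s))) \<partial>N) \<partial>N) \<le> ennreal D"
    and "0 \<le> D"
  shows "cmod (\<integral>t. cinner f (b t) \<partial>N) \<le> sqrt D * norm f"
proof -
  define v where "v g = (\<integral>t. cinner g (b t) \<partial>N)" for g
  have vadd: "v (x + y) = v x + v y" for x y
    unfolding v_def by (simp add: cinner_add_left Bochner_Integration.integral_add[OF int int])
  have vscale: "v (scaleC c x) = c * v x" for c x
    unfolding v_def by (simp add: cinner_scaleC_left)
  \<comment> \<open>The number \<open>\<beta>\<close> makes the functional continuous, hence
    representable; the final bound comes from D instead.\<close>
  have "\<exists>F. \<forall>x. Re (v x) = Re (cinner x F)"
  proof (rule riesz_real)
    show "Re (v (a *\<^sub>R x)) = a * Re (v x)" for a x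
      using vscale[of "of_real a" x] by (simp add: scaleC_of_real)
    show "\<bar>Re (v x)\<bar> \<le> \<beta> * norm x" for x
      using bdd[of x] abs_Re_le_cmod[of "v x"] by (simp add: v_def)
  qed (simp add: vadd)
  then obtain F where F: "\<And>x. Re (v x) = Re (cinner x F)" by blast
  \<comment> \<open>Imaginary parts follow from the real identity at
    \<open>scaleC \<i> x\<close>.\<close>
  have vF: "v x = cinner x F" for x
  proof (rule complex_eqI)
    show "Im (v x) = Im (cinner x F)"
      using F[of "scaleC \<i> x"] by (simp add: vscale cinner_scaleC_left)
  qed (rule F)
  \<comment> \<open>Evaluating v at F itself gives the squared norm, which is why the square root of
    D appears in the conclusion.\<close>
  have "ennreal ((norm F)\<^sup>2) = ennreal (cmod (v F))" by (simp add: vF cinner_self norm_power)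
  also have "\<dots> \<le> (\<integral>\<^sup>+t. ennreal (cmod (cinner F (b t))) \<partial>N)"
    unfolding v_def by (rule integral_norm_bound_ennreal[OF int])
  also have "\<dots> \<le> (\<integral>\<^sup>+t. (\<integral>\<^sup>+s. ennreal (cmod (cinner (b t) (b s))) \<partial>N) \<partial>N)"
  proof (rule nn_integral_mono)
    fix t
    have "ennreal (cmod (cinner F (b t))) = ennreal (cmod (v (b t)))"
      by (simp add: vF norm_cinner_commute)
    also have "\<dots> \<le> (\<integral>\<^sup>+s. ennreal (cmod (cinner (b t) (b s))) \<partial>N)"
      unfolding v_def by (rule integral_norm_bound_ennreal[OF int])
    finally show "ennreal (cmod (cinner F (b t))) \<le> \<dots>" .
  qed
  also note D
  finally have "(norm F)\<^sup>2 \<le> D" using \<open>0 \<le> D\<close> by simp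
  then have "norm F \<le> sqrt D" by (simp add: real_le_rsqrt)
  then have "norm f * norm F \<le> sqrt D * norm f" by (simp add: mult.commute mult_right_mono)
  then show ?thesis using norm_cinner_le[of f F] vF[of f] by (simp add: v_def)
qed

section \<open>Complex interpolation\<close>

text \<open>Hadamard's three lines theorem. Dividing by the interpolated edge bound makes both
  vertical edges bounded by 1, a Gaussian factor kills the function far up and down the strip, and
  the maximum principle on a large rectangle does the rest.\<close>

lemma three_lines_pos:
  fixes F :: "complex \<Rightarrow> complex"
  assumes hol: "F holomorphic_on UNIV"
    and bdd: "\<And>z. \<lbrakk>0 \<le> Re z; Re z \<le> 1\<rbrakk> \<Longrightarrow> cmod (F z) \<le> b"
    and F0: "\<And>y. cmod (F (Complex 0 y)) \<le> m0"
    and F1: "\<And>y. cmod (F (Complex 1 y)) \<le> m1"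
    and pos: "0 < m0" "0 < m1" and \<theta>: "0 < \<theta>" "\<theta> < 1"
  shows "cmod (F (of_real \<theta>)) \<le> m0 powr (1 - \<theta>) * m1 powr \<theta>"
proof -
  define l0 l1 where "l0 = ln m0" and "l1 = ln m1"
  \<comment> \<open>The first two terms give the factor modulus \<open>1 / m0\<close> on Re z = 0
    and \<open>1 / m1\<close> on Re z = 1. In the strip the real part of
    \<open>z\<^sup>2 - 1\<close> is at most \<open>- (Im z)\<^sup>2\<close>, so the \<epsilon> term
    never increases the modulus.\<close>
  define G where "G \<epsilon> z = F z * exp ((z - 1) * of_real l0 - z * of_real l1 + of_real \<epsilon> * (z\<^sup>2 - 1))"
    for \<epsilon> :: real and z
  have hG: "G \<epsilon> holomorphic_on UNIV" for \<epsilon>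
    unfolding G_def by (intro holomorphic_intros hol)
  have nG: "cmod (G \<epsilon> z) = cmod (F z) * exp ((Re z - 1) * l0 - Re z * l1 + \<epsilon> * ((Re z)\<^sup>2 - (Im z)\<^sup>2 - 1))"
    for \<epsilon> z
    by (simp add: G_def norm_mult power2_eq_square)
  have key: "cmod (G \<epsilon> (of_real \<theta>)) \<le> 1" if "0 < \<epsilon>" for \<epsilon>
  proof -
    \<comment> \<open>\<open>B\<close> bounds \<open>F\<close> times the normalising factor on the
      whole strip; on the edges |Im z| = R the Gaussian contributes at most
      \<open>exp (- \<epsilon> * R\<^sup>2)\<close>, and R is chosen to bring the product down to
      1.\<close>
    define B where "B = \<bar>b\<bar> * exp (\<bar>l0\<bar> + \<bar>l1\<bar>)"
    obtain R where R: "0 < R" "B * exp (- \<epsilon> * R\<^sup>2) \<le> 1"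
    proof -
      have "((\<lambda>R. B * exp (- \<epsilon> * R\<^sup>2)) \<longlongrightarrow> 0) at_top"
        using \<open>0 < \<epsilon>\<close> by real_asymp
      then have "eventually (\<lambda>R. B * exp (- \<epsilon> * R\<^sup>2) < 1) at_top"
        by (rule order_tendstoD) simp
      then have "eventually (\<lambda>R. 0 < R \<and> B * exp (- \<epsilon> * R\<^sup>2) < 1) at_top"
        using eventually_gt_at_top[of 0] by eventually_elim simp
      then show ?thesis using that eventually_happens'[OF trivial_limit_at_top_linorder]
        by (metis (lifting) less_imp_le)
    qed
    define S where "S = cbox (Complex 0 (- R)) (Complex 1 R)"
    have S: "S = {z. 0 \<le> Re z \<and> Re z \<le> 1 \<and> - R \<le> Im z \<and> Im z \<le> R}"
      by (auto simp: S_def in_cbox_complex_iff)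
    have iS: "interior S = {z. 0 < Re z \<and> Re z < 1 \<and> - R < Im z \<and> Im z < R}"
      by (auto simp: S_def interior_cbox in_box_complex_iff)
    have closedS: "closed S" and bS: "bounded S" by (auto simp: S_def)
    show ?thesis
    proof (rule maximum_modulus_frontier[where S = S and f = "G \<epsilon>"])
      show "G \<epsilon> holomorphic_on interior S" using hG holomorphic_on_subset by blast
      show "continuous_on (closure S) (G \<epsilon>)"
        using holomorphic_on_imp_continuous_on[OF hG[of \<epsilon>]] continuous_on_subset by blast
      show "complex_of_real \<theta> \<in> S" using \<theta> R by (simp add: S)
      fix z assume "z \<in> frontier S"
      then have z: "z \<in> S" and nz: "z \<notin> interior S"
        using closedS by (auto simp: frontier_def)
      consider "Re z = 0" | "Re z = 1" | "\<bar>Im z\<bar> = R"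
        using nz[unfolded iS] z[unfolded S] R unfolding mem_Collect_eq by (smt (verit))
      then show "cmod (G \<epsilon> z) \<le> 1"
      proof cases
        case 1
        then have "cmod (F z) \<le> m0" using F0[of "Im z"] by (metis complex_surj)
        moreover have "exp (- l0 + \<epsilon> * (- (Im z)\<^sup>2 - 1)) \<le> exp (- l0)" using mult_nonneg_nonpos[of \<epsilon> "- (Im z)\<^sup>2 - 1"] zero_le_power2[of "Im z"] \<open>0 < \<epsilon>\<close> by simp
        ultimately have "cmod (G \<epsilon> z) \<le> m0 * exp (- l0)"
          unfolding nG using 1 pos by (intro mult_mono) auto
        then show ?thesis using pos by (simp add: l0_def exp_minus)
      next
        case 2
        then have "cmod (F z) \<le> m1" using F1[of "Im z"] by (metis complex_surj)
        moreover have "exp (- l1 + \<epsilon> * (- (Im z)\<^sup>2)) \<le> exp (- l1)" using \<open>0 < \<epsilon>\<close> by simp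
        ultimately have "cmod (G \<epsilon> z) \<le> m1 * exp (- l1)"
          unfolding nG using 2 pos by (intro mult_mono) auto
        then show ?thesis using pos by (simp add: l1_def exp_minus)
      next
        case 3
        then have imz: "(Im z)\<^sup>2 = R\<^sup>2" by (metis power2_abs)
        have rz: "0 \<le> Re z" "Re z \<le> 1" using z by (auto simp: S)
        have "(Re z - 1) * l0 \<le> \<bar>l0\<bar>"
        proof -
          have "\<bar>(Re z - 1) * l0\<bar> \<le> 1 * \<bar>l0\<bar>" unfolding abs_mult using rz by (intro mult_right_mono) auto
          then show ?thesis by simp
        qed
        moreover have "- (Re z * l1) \<le> \<bar>l1\<bar>"
        proof -
          have "\<bar>Re z * l1\<bar> \<le> 1 * \<bar>l1\<bar>" unfolding abs_mult using rz by (intro mult_right_mono) auto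
          then show ?thesis by simp
        qed
        moreover have "\<epsilon> * ((Re z)\<^sup>2 - R\<^sup>2 - 1) \<le> \<epsilon> * (- R\<^sup>2)"
          using rz \<open>0 < \<epsilon>\<close> by (intro mult_left_mono) (auto simp: power_le_one)
        ultimately have "(Re z - 1) * l0 - Re z * l1 + \<epsilon> * ((Re z)\<^sup>2 - (Im z)\<^sup>2 - 1)
            \<le> (\<bar>l0\<bar> + \<bar>l1\<bar>) + - \<epsilon> * R\<^sup>2"
          unfolding imz by simp
        then have "cmod (G \<epsilon> z) \<le> \<bar>b\<bar> * exp ((\<bar>l0\<bar> + \<bar>l1\<bar>) + - \<epsilon> * R\<^sup>2)"
          unfolding nG using bdd[OF rz] by (intro mult_mono) auto
        also have "\<dots> = B * exp (- \<epsilon> * R\<^sup>2)" unfolding B_def by (simp add: exp_add[symmetric] algebra_simps)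
        finally show ?thesis using R by simp
      qed
    qed (rule bS)
  qed
  \<comment> \<open>\<epsilon> is sent to 0 with the point \<theta> fixed; R depended on \<epsilon>
    but no longer occurs.\<close>
  have "((\<lambda>\<epsilon>. cmod (G \<epsilon> (of_real \<theta>))) \<longlongrightarrow> cmod (G 0 (of_real \<theta>))) (at_right 0)"
    unfolding nG by (intro tendsto_intros)
  then have "cmod (G 0 (of_real \<theta>)) \<le> 1"
    by (rule tendsto_upperbound) (auto simp: eventually_at_right_less key intro!: eventually_at_rightI[of 0 1])
  then have "cmod (F (of_real \<theta>)) * exp (- ((1 - \<theta>) * l0 + \<theta> * l1)) \<le> 1"
    unfolding nG by (simp add: algebra_simps)
  then have "cmod (F (of_real \<theta>)) \<le> exp ((1 - \<theta>) * l0 + \<theta> * l1)"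
    unfolding exp_minus by (simp add: field_simps del: mult_exp_exp)
  also have "\<dots> = m0 powr (1 - \<theta>) * m1 powr \<theta>"
    using pos by (simp add: powr_def exp_add l0_def l1_def)
  finally show ?thesis .
qed

text \<open>An edge bound may vanish and then has no logarithm; both are raised by \<epsilon>, which
  is sent to 0. Since 0 < \<theta> < 1, both exponents are positive and \<open>powr\<close> is
  continuous at 0.\<close>

lemma three_lines:
  fixes F :: "complex \<Rightarrow> complex"
  assumes hol: "F holomorphic_on UNIV"
    and bdd: "\<And>z. \<lbrakk>0 \<le> Re z; Re z \<le> 1\<rbrakk> \<Longrightarrow> cmod (F z) \<le> b"
    and F0: "\<And>y. cmod (F (Complex 0 y)) \<le> m0"
    and F1: "\<And>y. cmod (F (Complex 1 y)) \<le> m1"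
    and \<theta>: "0 < \<theta>" "\<theta> < 1"
  shows "cmod (F (of_real \<theta>)) \<le> m0 powr (1 - \<theta>) * m1 powr \<theta>"
proof -
  have nonneg: "0 \<le> m0" "0 \<le> m1" using F0[of 0] F1[of 0] norm_ge_zero order_trans by blast+
  have "((\<lambda>\<epsilon>. (m0 + \<epsilon>) powr (1 - \<theta>) * (m1 + \<epsilon>) powr \<theta>) \<longlongrightarrow>
      (m0 + 0) powr (1 - \<theta>) * (m1 + 0) powr \<theta>) (at_right 0)"
    using \<theta> nonneg by (intro tendsto_intros tendsto_powr')
      (auto intro!: eventually_at_rightI[of 0 1])
  moreover have "cmod (F (of_real \<theta>)) \<le> (m0 + \<epsilon>) powr (1 - \<theta>) * (m1 + \<epsilon>) powr \<theta>" if "0 < \<epsilon>" for \<epsilon>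
    using that nonneg F0 F1 by (intro three_lines_pos[OF hol bdd _ _ _ _ \<theta>]) (auto intro: add_increasing2)
  ultimately show ?thesis
    by (intro tendsto_lowerbound[where F = "at_right 0"]) (auto intro!: eventually_at_rightI[of 0 1])
qed

text \<open>The complex exponent \<open>q (1 - z/2)\<close> turns \<open>|x|\<close> into \<open>|x|\<^sup>q\<close> on the line \<open>Re z = 0\<close> and
  into \<open>|x|\<^sup>q\<^sup>/\<^sup>2\<close> on \<open>Re z = 1\<close>; it equals \<open>1\<close> at \<open>z = \<theta>\<close>.\<close>

lemma riesz_thorin_matrix:
  fixes c :: "'i \<Rightarrow> 'j \<Rightarrow> complex" and x :: "'i \<Rightarrow> complex" and y :: "'j \<Rightarrow> complex"
    and s :: "'i \<Rightarrow> real" and t :: "'j \<Rightarrow> real"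
  assumes fin: "finite I" "finite J"
    and b1: "\<And>x y. cmod (\<Sum>i\<in>I. \<Sum>j\<in>J. x i * cnj (y j) * c i j)
        \<le> A * (\<Sum>i\<in>I. cmod (x i) * s i) * (\<Sum>j\<in>J. cmod (y j) * t j)"
    and b2: "\<And>x y. cmod (\<Sum>i\<in>I. \<Sum>j\<in>J. x i * cnj (y j) * c i j)
        \<le> B * sqrt (\<Sum>i\<in>I. (cmod (x i))\<^sup>2 * s i) * sqrt (\<Sum>j\<in>J. (cmod (y j))\<^sup>2 * t j)"
    and x: "\<And>i. i \<in> I \<Longrightarrow> x i \<noteq> 0" and y: "\<And>j. j \<in> J \<Longrightarrow> y j \<noteq> 0"
    and st: "\<And>i. i \<in> I \<Longrightarrow> 0 \<le> s i" "\<And>j. j \<in> J \<Longrightarrow> 0 \<le> t j"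
    and AB: "0 \<le> A" "0 \<le> B"
    and \<theta>: "0 < \<theta>" "\<theta> < 1" and q: "q * (1 - \<theta> / 2) = 1"
  shows "cmod (\<Sum>i\<in>I. \<Sum>j\<in>J. x i * cnj (y j) * c i j)
    \<le> A powr (1 - \<theta>) * B powr \<theta> *
      ((\<Sum>i\<in>I. cmod (x i) powr q * s i) powr (1 - \<theta> / 2) *
       (\<Sum>j\<in>J. cmod (y j) powr q * t j) powr (1 - \<theta> / 2))"
proof -
  define e where "e z = of_real q * (1 - z / 2)" for z :: complex
  define u where "u w z = sgn w * exp (e z * of_real (ln (cmod w)))" for w z :: complex
  \<comment> \<open>The form is antilinear in y. Conjugating \<open>u\<close> at
    \<open>cnj z\<close> restores holomorphy in z and leaves the moduli on the two edges
    unchanged.\<close>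
  define F where "F z = (\<Sum>i\<in>I. \<Sum>j\<in>J. u (x i) z * cnj (u (y j) (cnj z)) * c i j)" for z
  define X where "X = (\<Sum>i\<in>I. cmod (x i) powr q * s i)"
  define Y where "Y = (\<Sum>j\<in>J. cmod (y j) powr q * t j)"
  have XY: "0 \<le> X" "0 \<le> Y" unfolding X_def Y_def using st by (auto intro!: sum_nonneg)
  have cu: "cnj (u w (cnj z)) = cnj (sgn w) * exp (e z * of_real (ln (cmod w)))" for w z
    by (simp add: u_def e_def exp_cnj)
  have nu: "cmod (u w z) = cmod w powr (q * (1 - Re z / 2))" if "w \<noteq> 0" for w z
    using that by (simp add: u_def norm_mult norm_sgn e_def powr_def)
  have nu2: "(cmod (u w z))\<^sup>2 = cmod w powr q" if "w \<noteq> 0" "Re z = 1" for w z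
    using that by (simp add: nu powr_power)
  have hol: "F holomorphic_on UNIV"
    unfolding F_def cu unfolding u_def e_def by (intro holomorphic_intros) auto
  \<comment> \<open>The three lines theorem asks for some bound on the strip, and its size does not
    enter the result. In the strip the real part of 1 - z/2 lies between 1/2 and 1.\<close>
  obtain b where b: "\<And>z. \<lbrakk>0 \<le> Re z; Re z \<le> 1\<rbrakk> \<Longrightarrow> cmod (F z) \<le> b"
  proof
    fix z assume z: "0 \<le> Re z" "Re z \<le> 1"
    have 1: "cmod (u w z) \<le> exp (\<bar>q\<bar> * \<bar>ln (cmod w)\<bar>)" if "w \<noteq> 0" "0 \<le> Re z" "Re z \<le> 1" for w z
    proof -
      have "\<bar>q * (1 - Re z / 2) * ln (cmod w)\<bar> \<le> \<bar>q\<bar> * 1 * \<bar>ln (cmod w)\<bar>"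
        unfolding abs_mult using that by (intro mult_right_mono mult_left_mono) auto
      then show ?thesis using that by (simp add: nu powr_def)
    qed
    show "cmod (F z) \<le> (\<Sum>i\<in>I. \<Sum>j\<in>J. exp (\<bar>q\<bar> * \<bar>ln (cmod (x i))\<bar>) * exp (\<bar>q\<bar> * \<bar>ln (cmod (y j))\<bar>) * cmod (c i j))"
      unfolding F_def using z
      by (intro sum_norm_le) (auto simp: norm_mult x y intro!: mult_mono 1)
  qed
  have l0: "cmod (F (Complex 0 v)) \<le> A * X * Y" for v
  proof -
    have "cmod (F (Complex 0 v)) \<le> A * (\<Sum>i\<in>I. cmod (u (x i) (Complex 0 v)) * s i)
        * (\<Sum>j\<in>J. cmod (u (y j) (cnj (Complex 0 v))) * t j)"
      unfolding F_def by (rule b1)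
    also have "\<dots> = A * X * Y" unfolding X_def Y_def using x y by (simp add: nu cong: sum.cong)
    finally show ?thesis .
  qed
  have l1: "cmod (F (Complex 1 v)) \<le> B * sqrt X * sqrt Y" for v
  proof -
    have "cmod (F (Complex 1 v)) \<le> B * sqrt (\<Sum>i\<in>I. (cmod (u (x i) (Complex 1 v)))\<^sup>2 * s i)
        * sqrt (\<Sum>j\<in>J. (cmod (u (y j) (cnj (Complex 1 v))))\<^sup>2 * t j)"
      unfolding F_def by (rule b2)
    also have "\<dots> = B * sqrt X * sqrt Y" unfolding X_def Y_def using x y by (simp add: nu2 cong: sum.cong)
    finally show ?thesis .
  qed
  have e\<theta>: "e (of_real \<theta>) = 1" using q unfolding e_def
    by (metis of_real_1 of_real_diff of_real_divide of_real_mult of_real_numeral)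
  have u\<theta>: "u w (of_real \<theta>) = w" if "w \<noteq> 0" for w
    using that by (simp add: u_def e\<theta> sgn_eq exp_of_real)
  have "F (of_real \<theta>) = (\<Sum>i\<in>I. \<Sum>j\<in>J. x i * cnj (y j) * c i j)"
    unfolding F_def using x y by (simp add: u\<theta> cong: sum.cong)
  moreover have "cmod (F (of_real \<theta>)) \<le> (A * X * Y) powr (1 - \<theta>) * (B * sqrt X * sqrt Y) powr \<theta>"
    by (rule three_lines[OF hol b l0 l1 \<theta>])
  moreover have "(A * X * Y) powr (1 - \<theta>) * (B * sqrt X * sqrt Y) powr \<theta>
     = A powr (1 - \<theta>) * B powr \<theta> * (X powr (1 - \<theta> / 2) * Y powr (1 - \<theta> / 2))"
  proof -
    have *: "Z powr (1 - \<theta>) * sqrt Z powr \<theta> = Z powr (1 - \<theta> / 2)" if "0 \<le> Z" for Z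
      using that by (simp add: powr_half_sqrt[symmetric] powr_powr powr_add[symmetric])
    have "(A * X * Y) powr (1 - \<theta>) * (B * sqrt X * sqrt Y) powr \<theta>
      = A powr (1 - \<theta>) * B powr \<theta> * ((X powr (1 - \<theta>) * sqrt X powr \<theta>) * (Y powr (1 - \<theta>) * sqrt Y powr \<theta>))"
      using XY AB by (simp add: powr_mult)
    then show ?thesis using XY by (simp add: *)
  qed
  ultimately show ?thesis by (simp add: X_def Y_def)
qed

section \<open>The diagonal Hardy-Littlewood-Sobolev inequality\<close>

lemma nn_integral_abs_diff:
  fixes f :: "real \<Rightarrow> ennreal" and s :: real
  assumes [measurable]: "f \<in> borel_measurable borel"
  shows "(\<integral>\<^sup>+t. f \<bar>t - s\<bar> \<partial>lborel) = 2 * (\<integral>\<^sup>+t. f t * indicator {0..} t \<partial>lborel)"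
proof -
  have "(\<integral>\<^sup>+t. f \<bar>t - s\<bar> \<partial>lborel) = (\<integral>\<^sup>+t. f \<bar>t\<bar> \<partial>lborel)"
    by (subst nn_integral_real_affine[where c = 1 and t = s]) auto
  \<comment> \<open>The origin is counted in the first half only; both halves agree once the null
    set {0} is removed.\<close>
  also have "\<dots> = (\<integral>\<^sup>+t. f t * indicator {0..} t + f (- t) * indicator {0<..} (- t) \<partial>lborel)"
    by (intro nn_integral_cong) (auto split: split_indicator)
  also have "\<dots> = (\<integral>\<^sup>+t. f t * indicator {0..} t \<partial>lborel) + (\<integral>\<^sup>+t. f (- t) * indicator {0<..} (- t) \<partial>lborel)"
    by (rule nn_integral_add) auto
  also have "(\<integral>\<^sup>+t. f (- t) * indicator {0<..} (- t) \<partial>lborel) = (\<integral>\<^sup>+t. f t * indicator {0<..} t \<partial>lborel)"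
    by (subst nn_integral_real_affine[where c = "-1" and t = 0]) auto
  also have "\<dots> = (\<integral>\<^sup>+t. f t * indicator {0..} t \<partial>lborel)"
    by (rule nn_integral_cong_AE) (use AE_lborel_singleton[of "0::real"] in \<open>eventually_elim, auto split: split_indicator\<close>)
  finally show ?thesis by (simp add: mult_2)
qed

lemma nn_integral_powr_near:
  assumes "0 \<le> k" "k < 1" "0 < \<rho>"
  shows "(\<integral>\<^sup>+t. ennreal (\<bar>t - s\<bar> powr (- k)) * indicator {..\<rho>} \<bar>t - s\<bar> \<partial>lborel)
    = ennreal (2 * \<rho> powr (1 - k) / (1 - k))"
proof -
  have "(\<integral>\<^sup>+t. ennreal (\<bar>t - s\<bar> powr (- k)) * indicator {..\<rho>} \<bar>t - s\<bar> \<partial>lborel)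
    = 2 * (\<integral>\<^sup>+t. ennreal (t powr (- k)) * indicator {..\<rho>} t * indicator {0..} t \<partial>lborel)"
    by (rule nn_integral_abs_diff) measurable
  also have "(\<integral>\<^sup>+t. ennreal (t powr (- k)) * indicator {..\<rho>} t * indicator {0..} t \<partial>lborel)
    = (\<integral>\<^sup>+t. ennreal (t powr (- k)) * indicator {0..\<rho>} t \<partial>lborel)"
    by (intro nn_integral_cong) (auto split: split_indicator)
  also have "\<dots> = ennreal (\<rho> powr (- k + 1) / (- k + 1))"
    using assms by (intro nn_integral_has_integral_lebesgue' has_integral_powr_from_0) auto
  finally show ?thesis
    by (simp add: ennreal_mult'[symmetric] flip: ennreal_numeral)
qed

lemma nn_integral_powr_far:
  assumes "0 < \<rho>"
  shows "(\<integral>\<^sup>+t. ennreal (\<bar>t - s\<bar> powr (- 2)) * indicator {\<rho>..} \<bar>t - s\<bar> \<partial>lborel) = ennreal (2 / \<rho>)"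
proof -
  have "(\<integral>\<^sup>+t. ennreal (\<bar>t - s\<bar> powr (- 2)) * indicator {\<rho>..} \<bar>t - s\<bar> \<partial>lborel)
    = 2 * (\<integral>\<^sup>+t. ennreal (t powr (- 2)) * indicator {\<rho>..} t * indicator {0..} t \<partial>lborel)"
    by (rule nn_integral_abs_diff) measurable
  also have "(\<integral>\<^sup>+t. ennreal (t powr (- 2)) * indicator {\<rho>..} t * indicator {0..} t \<partial>lborel)
    = (\<integral>\<^sup>+t. ennreal (t powr (- 2)) * indicator {\<rho>..} t \<partial>lborel)"
    using assms by (intro nn_integral_cong) (auto split: split_indicator)
  also have "\<dots> = ennreal (- (\<rho> powr (- 2 + 1)) / (- 2 + 1))"
    using assms by (intro nn_integral_has_integral_lebesgue' has_integral_powr_to_inf) auto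
  finally show ?thesis using assms
    by (simp add: ennreal_mult'[symmetric] powr_minus_divide flip: ennreal_numeral)
qed

text \<open>The three summands are the contributions in \<open>hls_inner\<close>: the near part of
  the kernel integral, then the two terms of Young's inequality in the far part. The second argument
  is the exponent dual to r.\<close>

definition hls_const :: "real \<Rightarrow> real \<Rightarrow> real" where
  "hls_const r q = 2 / (1 - 2 / r) + 1 / q + 2 / r"

text \<open>The cut-off at distance \<open>a\<^sup>-\<^sup>q\<close> balances the two contributions, both of order \<open>a\<^sup>q\<^sup>-\<^sup>1\<close>.\<close>

lemma hls_inner:
  fixes w :: "real \<Rightarrow> real"
  assumes [measurable]: "w \<in> borel_measurable borel" and nn: "\<And>t. 0 \<le> w t"
    and r: "2 < r" and q: "1 < q" and rq: "1 / q + 1 / r = 1"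
    and w1: "(\<integral>\<^sup>+t. ennreal (w t powr q) \<partial>lborel) \<le> 1" and a: "0 < a"
  shows "(\<integral>\<^sup>+t. ennreal (w t * \<bar>t - s\<bar> powr (- 2 / r)) * indicator {..a} (w t) \<partial>lborel)
    \<le> ennreal (hls_const r q * a powr (q - 1))"
proof -
  define \<rho> where "\<rho> = a powr (- q)"
  have \<rho>: "0 < \<rho>" using a by (simp add: \<rho>_def)
  have qr: "q / r = q - 1" using rq q by (simp add: field_simps)
  have pw: "w t * \<bar>t - s\<bar> powr (- 2 / r) \<le> a powr (q - 1) / q * w t powr q + 1 / (a * r) * \<bar>t - s\<bar> powr (- 2)" for t
  proof -
    \<comment> \<open>Weights for Young's inequality: \<open>d powr q = a powr (q - 1)\<close> and
      \<open>d powr (- r) = 1 / a\<close>, so that after integration beyond \<rho> both terms scale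
      like \<open>a powr (q - 1)\<close>. The r-th power of the kernel is
      \<open>\<bar>t - s\<bar> powr (- 2)\<close>, integrable away from s.\<close>
    define d where "d = a powr (1 / r)"
    have "d > 0" using a by (simp add: d_def)
    have "(d * w t) * (\<bar>t - s\<bar> powr (- 2 / r) / d)
      \<le> (d * w t) powr q / q + (\<bar>t - s\<bar> powr (- 2 / r) / d) powr r / r"
      using r q rq nn \<open>d > 0\<close> by (intro Youngs_inequality) auto
    also have "(d * w t) powr q = a powr (q - 1) * w t powr q"
      using nn a by (simp add: d_def powr_mult powr_powr qr)
    also have "(\<bar>t - s\<bar> powr (- 2 / r) / d) powr r = \<bar>t - s\<bar> powr (- 2) / a"
      using a r by (simp add: d_def powr_divide powr_powr)
    finally show ?thesis using \<open>d > 0\<close> a r by (simp add: field_simps)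
  qed
  have "(\<integral>\<^sup>+t. ennreal (w t * \<bar>t - s\<bar> powr (- 2 / r)) * indicator {..a} (w t) \<partial>lborel)
    \<le> (\<integral>\<^sup>+t. ennreal a * (ennreal (\<bar>t - s\<bar> powr (- (2 / r))) * indicator {..\<rho>} \<bar>t - s\<bar>)
        + (ennreal (a powr (q - 1) / q) * ennreal (w t powr q)
        + ennreal (1 / (a * r)) * (ennreal (\<bar>t - s\<bar> powr (- 2)) * indicator {\<rho>..} \<bar>t - s\<bar>)) \<partial>lborel)"
  proof (intro nn_integral_mono)
    fix t
    \<comment> \<open>Near s the truncation replaces w by its bound a; away from s Young's
      inequality brings in the normalised integral of \<open>w t powr q\<close>.\<close>
    consider "w t > a" | "w t \<le> a" "\<bar>t - s\<bar> \<le> \<rho>" | "w t \<le> a" "\<bar>t - s\<bar> > \<rho>" by linarith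
    then show "ennreal (w t * \<bar>t - s\<bar> powr (- 2 / r)) * indicator {..a} (w t)
      \<le> ennreal a * (ennreal (\<bar>t - s\<bar> powr (- (2 / r))) * indicator {..\<rho>} \<bar>t - s\<bar>)
        + (ennreal (a powr (q - 1) / q) * ennreal (w t powr q)
        + ennreal (1 / (a * r)) * (ennreal (\<bar>t - s\<bar> powr (- 2)) * indicator {\<rho>..} \<bar>t - s\<bar>))"
    proof cases
      case 1 then show ?thesis by simp
    next
      case 2
      then have "ennreal (w t * \<bar>t - s\<bar> powr (- 2 / r)) \<le> ennreal (a * \<bar>t - s\<bar> powr (- (2 / r)))"
        by (intro ennreal_leI) (auto intro!: mult_right_mono)
      also have "\<dots> = ennreal a * (ennreal (\<bar>t - s\<bar> powr (- (2 / r))) * indicator {..\<rho>} \<bar>t - s\<bar>)"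
        using 2 a by (simp add: ennreal_mult)
      finally show ?thesis using 2 by (simp add: add_increasing2)
    next
      case 3
      then show ?thesis using ennreal_leI[OF pw[of t]] a r q nn
        by (simp add: ennreal_mult[symmetric] ennreal_plus[symmetric] del: ennreal_plus)
    qed
  qed
  also have "\<dots> = ennreal a * (\<integral>\<^sup>+t. ennreal (\<bar>t - s\<bar> powr (- (2 / r))) * indicator {..\<rho>} \<bar>t - s\<bar> \<partial>lborel)
      + (ennreal (a powr (q - 1) / q) * (\<integral>\<^sup>+t. ennreal (w t powr q) \<partial>lborel)
      + ennreal (1 / (a * r)) * (\<integral>\<^sup>+t. ennreal (\<bar>t - s\<bar> powr (- 2)) * indicator {\<rho>..} \<bar>t - s\<bar> \<partial>lborel))"
    by (simp add: nn_integral_add nn_integral_cmult)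
  also have "\<dots> \<le> ennreal a * ennreal (2 * \<rho> powr (1 - 2 / r) / (1 - 2 / r))
      + (ennreal (a powr (q - 1) / q) * 1 + ennreal (1 / (a * r)) * ennreal (2 / \<rho>))"
    using r by (intro add_mono mult_left_mono w1) (auto simp: nn_integral_powr_near nn_integral_powr_far \<rho>)
  also have "\<dots> = ennreal (a * (2 * \<rho> powr (1 - 2 / r) / (1 - 2 / r)) + (a powr (q - 1) / q + 1 / (a * r) * (2 / \<rho>)))"
    using a r q \<rho> by (simp add: ennreal_mult[symmetric] ennreal_plus[symmetric] del: ennreal_plus)
  also have "a * (2 * \<rho> powr (1 - 2 / r) / (1 - 2 / r)) + (a powr (q - 1) / q + 1 / (a * r) * (2 / \<rho>))
    = hls_const r q * a powr (q - 1)"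
  proof -
    have "- q * (1 - 2 / r) = 2 * (q / r) - q" by (simp add: algebra_simps)
    also have "\<dots> = q - 2" by (simp add: qr)
    finally have "- q * (1 - 2 / r) = q - 2" .
    then have "\<rho> powr (1 - 2 / r) = a powr (q - 2)" by (simp add: \<rho>_def powr_powr)
    moreover have "a powr (q - 1) = a * a powr (q - 2)"
      using a powr_add[of a 1 "q - 2"] by simp
    moreover have "1 / \<rho> = a * a powr (q - 1)"
      using a powr_add[of a 1 "q - 1"] by (simp add: \<rho>_def powr_minus_divide)
    then have "1 / (a * r) * (2 / \<rho>) = 2 / r * a powr (q - 1)"
      using a \<rho> r by (simp add: field_simps)
    ultimately show ?thesis by (simp add: hls_const_def algebra_simps)
  qed
  finally show ?thesis .
qed

text \<open>Taking a = w s in \<open>hls_inner\<close> bounds the truncated inner integral by a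
  multiple of \<open>w s powr (q - 1)\<close>; the outer factor w s completes it to
  \<open>w s powr q\<close>, whose integral is at most 1. The two halves give the factor 2.\<close>

lemma hls_borel:
  fixes w :: "real \<Rightarrow> real"
  assumes w[measurable]: "w \<in> borel_measurable borel" and nn: "\<And>t. 0 \<le> w t"
    and r: "2 < r" and q: "1 < q" and rq: "1 / q + 1 / r = 1"
    and w1: "(\<integral>\<^sup>+t. ennreal (w t powr q) \<partial>lborel) \<le> 1"
  shows "(\<integral>\<^sup>+s. (\<integral>\<^sup>+t. ennreal (w s * w t * \<bar>t - s\<bar> powr (- 2 / r)) \<partial>lborel) \<partial>lborel)
    \<le> ennreal (2 * hls_const r q)"
proof -
  define K where "K = hls_const r q"
  have K: "0 \<le> K" using r q by (simp add: K_def hls_const_def)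
  define f where "f s t = ennreal (w s * w t * \<bar>t - s\<bar> powr (- 2 / r)) * indicator {..w s} (w t)" for s t
  have "f = (\<lambda>s t. ennreal (w s * w t * \<bar>t - s\<bar> powr (- 2 / r)) * indicator {(s, t). w t \<le> w s} (s, t))"
    by (auto simp: f_def fun_eq_iff split: split_indicator)
  then have fm[measurable]: "case_prod f \<in> borel_measurable (lborel \<Otimes>\<^sub>M lborel)"
    by simp
  have half: "(\<integral>\<^sup>+s. (\<integral>\<^sup>+t. f s t \<partial>lborel) \<partial>lborel) \<le> ennreal K"
  proof -
    have "(\<integral>\<^sup>+t. f s t \<partial>lborel) \<le> ennreal K * ennreal (w s powr q)" for s
    proof (cases "w s = 0")
      case True then show ?thesis by (simp add: f_def)
    next
      case False
      then have ws: "0 < w s" using nn[of s] by simp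
      have "(\<integral>\<^sup>+t. f s t \<partial>lborel)
        = (\<integral>\<^sup>+t. ennreal (w s) * (ennreal (w t * \<bar>t - s\<bar> powr (- 2 / r)) * indicator {..w s} (w t)) \<partial>lborel)"
        unfolding f_def using nn by (intro nn_integral_cong) (simp add: ennreal_mult mult_ac)
      also have "\<dots> = ennreal (w s) * (\<integral>\<^sup>+t. ennreal (w t * \<bar>t - s\<bar> powr (- 2 / r)) * indicator {..w s} (w t) \<partial>lborel)"
        by (rule nn_integral_cmult) measurable
      also have "\<dots> \<le> ennreal (w s) * ennreal (K * w s powr (q - 1))"
        unfolding K_def by (intro mult_left_mono hls_inner w nn r q rq w1 ws) simp
      also have "\<dots> = ennreal (K * w s powr q)"
        using ws K powr_add[of "w s" 1 "q - 1"] by (simp add: ennreal_mult[symmetric] mult_ac)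
      finally show ?thesis using K by (simp add: ennreal_mult)
    qed
    then have "(\<integral>\<^sup>+s. (\<integral>\<^sup>+t. f s t \<partial>lborel) \<partial>lborel) \<le> (\<integral>\<^sup>+s. ennreal K * ennreal (w s powr q) \<partial>lborel)"
      by (rule nn_integral_mono)
    also have "\<dots> = ennreal K * (\<integral>\<^sup>+s. ennreal (w s powr q) \<partial>lborel)" by (rule nn_integral_cmult) measurable
    also have "\<dots> \<le> ennreal K * 1" by (intro mult_left_mono w1) simp
    finally show ?thesis by simp
  qed
  \<comment> \<open>Pairs with w s = w t are counted in both halves, which is harmless for an upper
    bound.\<close>
  have "(\<integral>\<^sup>+s. (\<integral>\<^sup>+t. ennreal (w s * w t * \<bar>t - s\<bar> powr (- 2 / r)) \<partial>lborel) \<partial>lborel)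
    \<le> (\<integral>\<^sup>+s. (\<integral>\<^sup>+t. f s t + f t s \<partial>lborel) \<partial>lborel)"
    unfolding f_def
    by (intro nn_integral_mono) (auto split: split_indicator simp: mult_ac abs_minus_commute add_increasing2)
  also have "\<dots> = (\<integral>\<^sup>+s. (\<integral>\<^sup>+t. f s t \<partial>lborel) + (\<integral>\<^sup>+t. f t s \<partial>lborel) \<partial>lborel)"
    by (intro nn_integral_cong nn_integral_add) measurable
  also have "\<dots> = (\<integral>\<^sup>+s. (\<integral>\<^sup>+t. f s t \<partial>lborel) \<partial>lborel) + (\<integral>\<^sup>+s. (\<integral>\<^sup>+t. f t s \<partial>lborel) \<partial>lborel)"
    by (rule nn_integral_add) measurable
  also have "(\<integral>\<^sup>+s. (\<integral>\<^sup>+t. f t s \<partial>lborel) \<partial>lborel) = (\<integral>\<^sup>+s. (\<integral>\<^sup>+t. f s t \<partial>lborel) \<partial>lborel)"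
    by (rule lborel_pair.Fubini'[OF fm])
  also have "(\<integral>\<^sup>+s. (\<integral>\<^sup>+t. f s t \<partial>lborel) \<partial>lborel) + (\<integral>\<^sup>+s. (\<integral>\<^sup>+t. f s t \<partial>lborel) \<partial>lborel) \<le> ennreal K + ennreal K"
    by (intro add_mono half)
  finally show ?thesis using K by (simp add: K_def ennreal_mult flip: mult_2)
qed

text \<open>The previous bound exchanges integrals over \<open>lborel\<close> and hence needs a
  Borel function. A Borel representative of w is inserted for almost every s and, inside, for almost
  every t; the iterated integral does not change.\<close>

lemma hls_lebesgue:
  fixes w :: "real \<Rightarrow> real"
  assumes w: "w \<in> borel_measurable lebesgue" and nn: "\<And>t. 0 \<le> w t"
    and r: "2 < r" and q: "1 < q" and rq: "1 / q + 1 / r = 1"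
    and w1: "(\<integral>\<^sup>+t. ennreal (w t powr q) \<partial>lebesgue) \<le> 1"
  shows "(\<integral>\<^sup>+s. (\<integral>\<^sup>+t. K * ennreal (w s * w t * \<bar>t - s\<bar> powr (- 2 / r)) \<partial>lebesgue) \<partial>lebesgue)
    \<le> K * ennreal (2 * hls_const r q)"
proof -
  obtain w0 where w0: "w0 \<in> borel_measurable borel" "AE t in lborel. w t = w0 t"
    using completion_ex_borel_measurable_real[OF w] by auto
  \<comment> \<open>The representative may be negative on a null set, hence the absolute
    value.\<close>
  define v where "v t = \<bar>w0 t\<bar>" for t
  have [measurable]: "v \<in> borel_measurable borel" unfolding v_def using w0(1) by measurable
  have ae: "AE t in lborel. w t = v t"
    using w0(2) by eventually_elim (metis abs_of_nonneg nn v_def)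
  have "(\<integral>\<^sup>+s. (\<integral>\<^sup>+t. K * ennreal (w s * w t * \<bar>t - s\<bar> powr (- 2 / r)) \<partial>lborel) \<partial>lborel)
    = (\<integral>\<^sup>+s. (\<integral>\<^sup>+t. K * ennreal (v s * v t * \<bar>t - s\<bar> powr (- 2 / r)) \<partial>lborel) \<partial>lborel)"
  proof (intro nn_integral_cong_AE)
    show "AE s in lborel. (\<integral>\<^sup>+t. K * ennreal (w s * w t * \<bar>t - s\<bar> powr (- 2 / r)) \<partial>lborel)
      = (\<integral>\<^sup>+t. K * ennreal (v s * v t * \<bar>t - s\<bar> powr (- 2 / r)) \<partial>lborel)"
      using ae
    proof eventually_elim
      case (elim s)
      show ?case by (rule nn_integral_cong_AE) (use ae in \<open>eventually_elim, simp add: elim\<close>)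
    qed
  qed
  also have "\<dots> = K * (\<integral>\<^sup>+s. (\<integral>\<^sup>+t. ennreal (v s * v t * \<bar>t - s\<bar> powr (- 2 / r)) \<partial>lborel) \<partial>lborel)"
    by (simp add: nn_integral_cmult)
  also have "\<dots> \<le> K * ennreal (2 * hls_const r q)"
  proof (intro mult_left_mono, rule hls_borel[OF \<open>v \<in> borel_measurable borel\<close> _ r q rq])
    have "(\<integral>\<^sup>+t. ennreal (v t powr q) \<partial>lborel) = (\<integral>\<^sup>+t. ennreal (w t powr q) \<partial>lborel)"
      by (rule nn_integral_cong_AE) (use ae in \<open>eventually_elim, simp\<close>)
    then show "(\<integral>\<^sup>+t. ennreal (v t powr q) \<partial>lborel) \<le> 1"
      using w1 by (simp add: nn_integral_completion)
  qed (auto simp: v_def)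
  finally show ?thesis by (simp add: nn_integral_completion)
qed

section \<open>Duality of Lp norms\<close>

lemma ennreal_powr_ennreal [simp]: "0 \<le> x \<Longrightarrow> ennreal_powr (ennreal x) a = ennreal (x powr a)"
  by (simp add: ennreal_powr_def)

lemma ennreal_powr_top [simp]: "ennreal_powr top a = top"
  by (simp add: ennreal_powr_def)

lemma ennreal_powr_zero [simp]: "ennreal_powr 0 a = 0"
  by (simp add: ennreal_powr_def)

lemma ennreal_powr_mono: "x \<le> y \<Longrightarrow> 0 \<le> a \<Longrightarrow> ennreal_powr x a \<le> ennreal_powr y a"
  by (cases x; cases y) (auto simp: top_unique intro!: ennreal_leI powr_mono2)

lemma ennreal_powr_powr_inverse:
  assumes "a \<noteq> 0"
  shows "ennreal_powr (ennreal_powr x a) (1 / a) = x"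
  by (cases x) (use assms in \<open>auto simp: powr_powr\<close>)

lemma ennreal_powr_inverse_powr:
  assumes "a \<noteq> 0"
  shows "ennreal_powr (ennreal_powr x (1 / a)) a = x"
  using ennreal_powr_powr_inverse[of "1 / a" x] assms by simp

lemma ennreal_powr_two: "ennreal_powr x 2 = x\<^sup>2"
  by (cases x) (auto simp: ennreal_power)

lemma measurable_ennreal_powr [measurable]:
  assumes [measurable]: "f \<in> borel_measurable M"
  shows "(\<lambda>x. ennreal_powr (f x) a) \<in> borel_measurable M"
  unfolding ennreal_powr_def by measurable

abbreviation finite_simple :: "'a measure \<Rightarrow> ('a \<Rightarrow> 'b::real_vector) \<Rightarrow> bool" where
  "finite_simple \<equiv> Bochner_Integration.simple_bochner_integrable"

lemma finite_simple_measurable: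
  fixes f :: "'a \<Rightarrow> 'b::real_normed_vector"
  shows "finite_simple M f \<Longrightarrow> f \<in> borel_measurable M"
  by (auto elim: simple_bochner_integrable.cases intro: borel_measurable_simple_function)

lemma borel_measurable_cnj [measurable (raw)]:
  "f \<in> borel_measurable M \<Longrightarrow> (\<lambda>x. cnj (f x)) \<in> borel_measurable M"
  using continuous_on_cnj[OF continuous_on_id, of UNIV]
  by (rule borel_measurable_continuous_on[where f = cnj]) auto

text \<open>Converse Hoelder inequality. In place of \<sigma>-finiteness of M, countably many sets
  of finite measure cover the points where F does not vanish. F and its norm may be infinite, hence
  the formulation with an arbitrary a below the norm. It serves both for the space variable and for
  time.\<close>

lemma ennreal_Lp_norm_dual_witness:
  fixes F :: "'a \<Rightarrow> ennreal" and E :: "nat \<Rightarrow> 'a set"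
  assumes F[measurable]: "F \<in> borel_measurable M"
    and E[measurable]: "\<And>n. E n \<in> sets M" and fin: "\<And>n. emeasure M (E n) \<noteq> \<infinity>"
    and cover: "\<And>x. x \<in> space M \<Longrightarrow> F x \<noteq> 0 \<Longrightarrow> x \<in> (\<Union>n. E n)"
    and p: "1 < p" and q: "1 \<le> q" and pq: "1 / q + enn2real (1 / p) = 1"
    and a: "a < ennreal_Lp_norm M p F"
  shows "\<exists>\<sigma>::'a \<Rightarrow> real. finite_simple M \<sigma> \<and> (\<forall>x. 0 \<le> \<sigma> x)
    \<and> (\<integral>\<^sup>+x. ennreal (\<sigma> x powr q) \<partial>M) \<le> 1 \<and> a < (\<integral>\<^sup>+x. ennreal (\<sigma> x) * F x \<partial>M)"
proof (cases "p = \<infinity>")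
  case True
  then have q1: "q = 1" using pq q by simp
  \<comment> \<open>A level b strictly between a and the essential supremum leaves a superlevel set
    of positive measure; a piece of it with finite positive measure carries the normalised
    indicator.\<close>
  obtain b where b: "a < b" "b < esssup M F"
    using a True dense by (auto simp: ennreal_Lp_norm_def)
  have "F x \<noteq> 0" if "b < F x" for x using that by auto
  then have eq: "{x \<in> space M. F x > b} = (\<Union>n. {x \<in> space M. F x > b} \<inter> E n)"
    using cover by blast
  have "0 < emeasure M {x \<in> space M. F x > b}" by (rule esssup_pos_measure[OF F b(2)])
  also note eq
  finally have "emeasure M (\<Union>n. {x \<in> space M. F x > b} \<inter> E n) \<noteq> 0" by simp
  moreover have "range (\<lambda>n. {x \<in> space M. F x > b} \<inter> E n) \<subseteq> sets M" by auto
  ultimately obtain n where n: "emeasure M ({x \<in> space M. F x > b} \<inter> E n) \<noteq> 0"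
    using emeasure_UN_eq_0[of M "\<lambda>n. {x \<in> space M. F x > b} \<inter> E n"] by blast
  define S where "S = {x \<in> space M. F x > b} \<inter> E n"
  have S[measurable]: "S \<in> sets M" unfolding S_def by measurable
  have "emeasure M S \<le> emeasure M (E n)" unfolding S_def by (intro emeasure_mono) auto
  then have Sfin: "emeasure M S \<noteq> \<infinity>" using fin[of n] by (auto simp: top_unique)
  define m where "m = measure M S"
  have eS: "emeasure M S = ennreal m" using Sfin unfolding m_def by (simp add: emeasure_eq_ennreal_measure)
  then have m: "0 < m" using n by (simp add: S_def[symmetric] ennreal_eq_0_iff)
  define \<sigma> where "\<sigma> x = indicator S x / m" for x
  have fs: "finite_simple M \<sigma>"
  proof
    have "simple_function M (indicator S :: 'a \<Rightarrow> real)" by (rule simple_function_indicator[OF S])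
    then show "simple_function M \<sigma>" unfolding \<sigma>_def by (rule simple_function_compose1)
    have "{y \<in> space M. \<sigma> y \<noteq> 0} \<subseteq> S" by (auto simp: \<sigma>_def split: split_indicator_asm)
    then have "emeasure M {y \<in> space M. \<sigma> y \<noteq> 0} \<le> emeasure M S" by (intro emeasure_mono) auto
    then show "emeasure M {y \<in> space M. \<sigma> y \<noteq> 0} \<noteq> \<infinity>" using Sfin by (auto simp: top_unique)
  qed
  have nn: "0 \<le> \<sigma> x" for x using m by (simp add: \<sigma>_def)
  have eq: "ennreal (\<sigma> x) = ennreal (1 / m) * indicator S x" for x
    using m by (simp add: \<sigma>_def split: split_indicator)
  have one: "ennreal (1 / m) * emeasure M S = 1"
    unfolding eS using m by (simp add: ennreal_mult[symmetric])
  have "(\<integral>\<^sup>+x. ennreal (\<sigma> x powr q) \<partial>M) = (\<integral>\<^sup>+x. ennreal (1 / m) * indicator S x \<partial>M)"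
    using nn by (simp add: q1 eq)
  also have "\<dots> = 1" by (simp add: nn_integral_cmult_indicator one)
  finally have s1: "(\<integral>\<^sup>+x. ennreal (\<sigma> x powr q) \<partial>M) \<le> 1" by simp
  have "a < (\<integral>\<^sup>+x. ennreal (\<sigma> x) * F x \<partial>M)"
  proof -
    note b(1)
    also have "b = b * ennreal (1 / m) * emeasure M S" using one by (simp add: mult.assoc)
    also have "\<dots> = (\<integral>\<^sup>+x. (b * ennreal (1 / m)) * indicator S x \<partial>M)" by (simp add: nn_integral_cmult_indicator)
    also have "\<dots> \<le> (\<integral>\<^sup>+x. ennreal (\<sigma> x) * F x \<partial>M)"
    proof (intro nn_integral_mono)
      fix x
      have "b \<le> F x" if "x \<in> S" using that by (auto simp: S_def)
      then show "b * ennreal (1 / m) * indicator S x \<le> ennreal (\<sigma> x) * F x"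
        by (auto simp: eq mult.commute intro!: mult_right_mono split: split_indicator)
    qed
    finally show ?thesis .
  qed
  then show ?thesis using fs nn s1 by blast
next
  case False
  define P where "P = enn2real p"
  have pP: "p = ennreal P" using False by (simp add: P_def less_top[symmetric])
  have P: "1 < P" using p unfolding pP by (simp add: ennreal_less_iff[of 1, simplified])
  have "enn2real (1 / p) = 1 / P" using P unfolding pP
    by (simp add: divide_ennreal_def inverse_ennreal inverse_eq_divide)
  then have pq': "1 / q + 1 / P = 1" using pq by simp
  define I where "I = (\<integral>\<^sup>+x. ennreal_powr (F x) P \<partial>M)"
  have aI: "a < ennreal_powr I (1 / P)" using a False by (simp add: ennreal_Lp_norm_def I_def P_def)
  have "ennreal_powr a P < I"
  proof (rule ccontr)
    assume "\<not> ennreal_powr a P < I"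
    then have "ennreal_powr I (1 / P) \<le> ennreal_powr (ennreal_powr a P) (1 / P)"
      using P by (intro ennreal_powr_mono) auto
    then show False using aI P by (simp add: ennreal_powr_powr_inverse)
  qed
  then obtain g where g: "simple_function M g" "g \<le> (\<lambda>x. ennreal_powr (F x) P)" "\<And>x. g x < top"
    and ag: "ennreal_powr a P < integral\<^sup>S M g"
    unfolding I_def nn_integral_def_finite by (auto simp: less_SUP_iff)
  have [measurable]: "g \<in> borel_measurable M" using g(1) by (rule borel_measurable_simple_function)
  \<comment> \<open>Increasing unions turn the truncations of g into a monotone sequence; some
    \<open>A n\<close>, a set of finite measure, keeps the integral above
    \<open>ennreal_powr a P\<close>.\<close>
  define A where "A n = (\<Union>i\<le>n. E i)" for n
  have Am[measurable]: "A n \<in> sets M" for n unfolding A_def by measurable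
  have gA: "g x = (SUP n. g x * indicator (A n) x)" if "x \<in> space M" for x
  proof (cases "g x = 0")
    case nz: False
    have "F x \<noteq> 0" using g(2) nz by (auto simp: le_fun_def dest!: spec[of _ x])
    then obtain n where "x \<in> E n" using cover \<open>x \<in> space M\<close> by blast
    then have "x \<in> A n" by (auto simp: A_def)
    then have "g x \<le> (SUP n. g x * indicator (A n) x)" by (intro SUP_upper2[of n]) auto
    moreover have "(SUP n. g x * indicator (A n) x) \<le> g x" by (intro SUP_least) (auto split: split_indicator)
    ultimately show ?thesis by (rule antisym)
  qed simp
  have "incseq (\<lambda>n x. g x * indicator (A n) x)"
    by (auto simp: incseq_def le_fun_def A_def intro!: mult_left_mono split: split_indicator)
  then have "(\<integral>\<^sup>+x. (SUP n. g x * indicator (A n) x) \<partial>M) = (SUP n. \<integral>\<^sup>+x. g x * indicator (A n) x \<partial>M)"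
    by (rule nn_integral_monotone_convergence_SUP) measurable
  then have "integral\<^sup>S M g = (SUP n. \<integral>\<^sup>+x. g x * indicator (A n) x \<partial>M)"
    using g(1) gA by (simp add: nn_integral_eq_simple_integral[symmetric] cong: nn_integral_cong)
  then obtain n where n: "ennreal_powr a P < (\<integral>\<^sup>+x. g x * indicator (A n) x \<partial>M)"
    using ag by (auto simp: less_SUP_iff)
  define \<tau> where "\<tau> x = enn2real (g x * indicator (A n) x)" for x
  have \<tau>0: "0 \<le> \<tau> x" for x by (simp add: \<tau>_def)
  have e\<tau>: "ennreal (\<tau> x) = g x * indicator (A n) x" for x
    using g(3)[of x] by (simp add: \<tau>_def split: split_indicator)
  have \<tau>F: "ennreal (\<tau> x powr (1 / P)) \<le> F x" for x
  proof -
    have "ennreal (\<tau> x) \<le> ennreal_powr (F x) P"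
      unfolding e\<tau> using g(2) by (auto simp: le_fun_def split: split_indicator)
    then have "ennreal_powr (ennreal (\<tau> x)) (1 / P) \<le> ennreal_powr (ennreal_powr (F x) P) (1 / P)"
      using P by (intro ennreal_powr_mono) auto
    then show ?thesis using P by (simp add: ennreal_powr_powr_inverse \<tau>0)
  qed
  have \<tau>s: "finite_simple M \<tau>"
  proof
    have "simple_function M (indicator (A n) :: 'a \<Rightarrow> ennreal)" by (rule simple_function_indicator[OF Am])
    then show "simple_function M \<tau>" unfolding \<tau>_def by (rule simple_function_compose2[OF g(1)])
    have "emeasure M (A n) \<le> (\<Sum>i\<le>n. emeasure M (E i))"
      unfolding A_def by (intro emeasure_subadditive_finite) auto
    also have "\<dots> < \<infinity>" using fin by (simp add: less_top[symmetric])
    finally have Afin: "emeasure M (A n) < \<infinity>" .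
    have "{y \<in> space M. \<tau> y \<noteq> 0} \<subseteq> A n" by (auto simp: \<tau>_def split: split_indicator_asm)
    then have "emeasure M {y \<in> space M. \<tau> y \<noteq> 0} \<le> emeasure M (A n)" by (intro emeasure_mono) auto
    then show "emeasure M {y \<in> space M. \<tau> y \<noteq> 0} \<noteq> \<infinity>" using Afin by auto
  qed
  have [measurable]: "\<tau> \<in> borel_measurable M" by (rule finite_simple_measurable[OF \<tau>s])
  define T where "T = Bochner_Integration.simple_bochner_integral M \<tau>"
  have T: "(\<integral>\<^sup>+x. ennreal (\<tau> x) \<partial>M) = ennreal T"
    unfolding T_def using \<tau>s \<tau>0 by (simp add: simple_bochner_integral_eq_nn_integral)
  have aT: "ennreal_powr a P < ennreal T" using n unfolding T[symmetric] e\<tau> .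
  then have Tpos: "0 < T" by (metis ennreal_neg linorder_not_le not_less_zero)
  have "a < ennreal (T powr (1 / P))"
  proof (rule ccontr)
    assume "\<not> a < ennreal (T powr (1 / P))"
    then have "ennreal_powr (ennreal_powr (ennreal T) (1 / P)) P \<le> ennreal_powr a P"
      using P Tpos by (intro ennreal_powr_mono) auto
    then show False using aT P by (simp add: ennreal_powr_inverse_powr)
  qed
  \<comment> \<open>Extremal function for Hoelder: as \<open>\<tau> x powr (1 / P)\<close> is below
    F x, the product of \<sigma> and F dominates \<open>\<tau> x / T powr (1 / q)\<close>, whose
    integral is \<open>T powr (1 / P)\<close>.\<close>
  define \<sigma> where "\<sigma> x = \<tau> x powr (1 / q) / T powr (1 / q)" for x
  have "finite_simple M \<sigma>" unfolding \<sigma>_def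
    using simple_bochner_integrable_compose2[where p = "\<lambda>x y. x powr (1 / q) / T powr (1 / q)", OF _ \<tau>s \<tau>s] by simp
  moreover have "0 \<le> \<sigma> x" for x by (simp add: \<sigma>_def)
  moreover have "(\<integral>\<^sup>+x. ennreal (\<sigma> x powr q) \<partial>M) \<le> 1"
  proof -
    have "ennreal (\<sigma> x powr q) = ennreal (1 / T) * ennreal (\<tau> x)" for x
      using Tpos q \<tau>0 by (simp add: \<sigma>_def powr_divide powr_powr ennreal_mult[symmetric])
    then have "(\<integral>\<^sup>+x. ennreal (\<sigma> x powr q) \<partial>M) = ennreal (1 / T) * ennreal T"
      by (simp add: nn_integral_cmult T)
    also have "\<dots> = 1" using Tpos by (simp add: ennreal_mult[symmetric])
    finally show ?thesis by simp
  qed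
  moreover have "a < (\<integral>\<^sup>+x. ennreal (\<sigma> x) * F x \<partial>M)"
  proof -
    have "T powr (1 / P) * T powr (1 / q) = T"
      using Tpos pq' by (simp add: powr_add[symmetric] add.commute)
    then have "T powr (1 / P) = 1 / T powr (1 / q) * T" using Tpos by (simp add: field_simps)
    then have "ennreal (T powr (1 / P)) = ennreal (1 / T powr (1 / q)) * ennreal T"
      using Tpos by (simp add: ennreal_mult[symmetric])
    also have "\<dots> = (\<integral>\<^sup>+x. ennreal (1 / T powr (1 / q)) * ennreal (\<tau> x) \<partial>M)"
      by (simp add: nn_integral_cmult T)
    also have "\<dots> \<le> (\<integral>\<^sup>+x. ennreal (\<sigma> x) * F x \<partial>M)"
    proof (intro nn_integral_mono)
      fix x
      have "\<tau> x = \<tau> x powr (1 / q) * \<tau> x powr (1 / P)"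
        using \<tau>0[of x] pq' by (simp add: powr_add[symmetric])
      then have "1 / T powr (1 / q) * \<tau> x = \<sigma> x * \<tau> x powr (1 / P)"
        unfolding \<sigma>_def by (metis times_divide_eq_left mult_1)
      then have "ennreal (1 / T powr (1 / q)) * ennreal (\<tau> x) = ennreal (\<sigma> x) * ennreal (\<tau> x powr (1 / P))"
        by (subst (1 2) ennreal_mult''[symmetric]) (simp_all add: \<tau>0)
      also have "\<dots> \<le> ennreal (\<sigma> x) * F x" by (intro mult_left_mono \<tau>F) simp
      finally show "ennreal (1 / T powr (1 / q)) * ennreal (\<tau> x) \<le> \<dots>" .
    qed
    finally show ?thesis using \<open>a < ennreal (T powr (1 / P))\<close> by simp
  qed
  ultimately show ?thesis by blast
qed

text \<open>For finite p, Young's inequality is integrated for \<sigma> and F divided by its norm g;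
  multiplied back by g, the two terms contribute at most g/q and g/P, which add up to g. Norm zero
  or infinite is treated apart, as F cannot be normalised then.\<close>

lemma ennreal_Lp_norm_hoelder:
  fixes F :: "'a \<Rightarrow> ennreal" and \<sigma> :: "'a \<Rightarrow> real"
  assumes F[measurable]: "F \<in> borel_measurable M" and [measurable]: "\<sigma> \<in> borel_measurable M"
    and \<sigma>0: "\<And>x. 0 \<le> \<sigma> x"
    and p: "1 < p" and q: "1 \<le> q" and pq: "1 / q + enn2real (1 / p) = 1"
    and \<sigma>1: "(\<integral>\<^sup>+x. ennreal (\<sigma> x powr q) \<partial>M) \<le> 1"
  shows "(\<integral>\<^sup>+x. ennreal (\<sigma> x) * F x \<partial>M) \<le> ennreal_Lp_norm M p F"
proof (cases "p = \<infinity>")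
  case True
  then have q1: "q = 1" using pq q by simp
  have "(\<integral>\<^sup>+x. ennreal (\<sigma> x) * F x \<partial>M) \<le> (\<integral>\<^sup>+x. esssup M F * ennreal (\<sigma> x) \<partial>M)"
    by (rule nn_integral_mono_AE)
      (use esssup_AE[where f = F and M = M] in \<open>eventually_elim, auto simp: mult.commute intro!: mult_right_mono\<close>)
  also have "\<dots> = esssup M F * (\<integral>\<^sup>+x. ennreal (\<sigma> x) \<partial>M)" by (rule nn_integral_cmult) measurable
  also have "\<dots> \<le> esssup M F * 1" using \<sigma>1 \<sigma>0 by (intro mult_left_mono) (auto simp: q1)
  finally show ?thesis using True by (simp add: ennreal_Lp_norm_def)
next
  case False
  define P where "P = enn2real p"
  have pP: "p = ennreal P" using False by (simp add: P_def less_top[symmetric])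
  have P: "1 < P" using p unfolding pP by (simp add: ennreal_less_iff[of 1, simplified])
  have "enn2real (1 / p) = 1 / P" using P unfolding pP
    by (simp add: divide_ennreal_def inverse_ennreal inverse_eq_divide)
  then have pq': "1 / q + 1 / P = 1" using pq by simp
  then have q1: "1 < q" using P q by (cases "q = 1") auto
  define I where "I = (\<integral>\<^sup>+x. ennreal_powr (F x) P \<partial>M)"
  have N: "ennreal_Lp_norm M p F = ennreal_powr I (1 / P)"
    using False by (simp add: ennreal_Lp_norm_def I_def P_def)
  consider "I = 0" | "I = top" | G where "I = ennreal G" "0 < G"
    by (cases I) (auto simp: zero_less_iff_neq_zero, fastforce)
  then show ?thesis
  proof cases
    case 1
    then have "AE x in M. ennreal_powr (F x) P = 0" unfolding I_def by (subst (asm) nn_integral_0_iff_AE) auto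
    then have "AE x in M. F x = 0"
    proof eventually_elim
      case (elim x)
      then show ?case using ennreal_powr_powr_inverse[of P "F x"] P by simp
    qed
    then have "(\<integral>\<^sup>+x. ennreal (\<sigma> x) * F x \<partial>M) = 0"
      by (subst nn_integral_0_iff_AE) auto
    then show ?thesis by simp
  next
    case 2 then show ?thesis by (simp add: N)
  next
    case (3 G)
    define g where "g = G powr (1 / P)"
    have g: "0 < g" "g powr P = G" using 3 P by (auto simp: g_def powr_powr)
    have "(\<integral>\<^sup>+x. ennreal (\<sigma> x) * F x \<partial>M)
      \<le> (\<integral>\<^sup>+x. ennreal (g / q) * ennreal (\<sigma> x powr q) + ennreal (g / (P * G)) * ennreal_powr (F x) P \<partial>M)"
    proof (intro nn_integral_mono)
      fix x
      show "ennreal (\<sigma> x) * F x \<le> ennreal (g / q) * ennreal (\<sigma> x powr q) + ennreal (g / (P * G)) * ennreal_powr (F x) P"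
      proof (cases "F x")
        case (real f)
        have "\<sigma> x * (f / g) \<le> \<sigma> x powr q / q + (f / g) powr P / P"
          using P q1 pq' \<sigma>0 real g by (intro Youngs_inequality) auto
        also have "(f / g) powr P = f powr P / G" using real g by (simp add: powr_divide)
        finally have "\<sigma> x * f \<le> g / q * \<sigma> x powr q + g / (P * G) * f powr P"
          using g 3 P q1 by (simp add: field_simps)
        then have "ennreal (\<sigma> x * f) \<le> ennreal (g / q * \<sigma> x powr q + g / (P * G) * f powr P)"
          by (rule ennreal_leI)
        then show ?thesis using real \<sigma>0 g 3 P q1
          by (simp add: ennreal_mult[symmetric] ennreal_plus[symmetric] del: ennreal_plus)
      next
        case top
        have "0 < g / (P * G)" using g 3 P by simp
        then show ?thesis using top g 3 P by (simp add: ennreal_mult_top)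
      qed
    qed
    also have "\<dots> = ennreal (g / q) * (\<integral>\<^sup>+x. ennreal (\<sigma> x powr q) \<partial>M) + ennreal (g / (P * G)) * I"
      by (simp add: nn_integral_add nn_integral_cmult I_def)
    also have "\<dots> \<le> ennreal (g / q) * 1 + ennreal (g / (P * G)) * ennreal G"
      unfolding 3 by (intro add_mono mult_left_mono \<sigma>1) auto
    also have "\<dots> = ennreal (g * (1 / q + 1 / P))"
      using g 3 P q1 by (simp add: ennreal_mult[symmetric] ennreal_plus[symmetric] algebra_simps del: ennreal_plus)
    also have "\<dots> = ennreal_Lp_norm M p F" using 3 by (simp add: N pq' g_def)
    finally show ?thesis .
  qed
qed

text \<open>Unit ball of L^q, cut down to simple functions supported on sets of finite measure.
  These belong to L^1 and L^2 simultaneously, so the adjoint and both estimates apply to every test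
  function, whatever q is. Comparing the integral with 1, and not its root, defines the same
  ball.\<close>

definition dual_ball :: "'a measure \<Rightarrow> real \<Rightarrow> ('a \<Rightarrow> complex) set" where
  "dual_ball M q = {\<psi>. finite_simple M \<psi> \<and> (\<integral>\<^sup>+x. ennreal (cmod (\<psi> x) powr q) \<partial>M) \<le> 1}"

text \<open>Pairing with \<open>\<sigma> x * sgn (g x)\<close> would give exactly the integral of
  \<open>\<sigma> x * cmod (g x)\<close>, but the sign of g need not be simple. Simple
  approximations of it are used, and dominated convergence lifts the pairing above a.\<close>

lemma phase_approximation:
  fixes g :: "'a \<Rightarrow> complex"
  assumes g[measurable]: "g \<in> borel_measurable M"
    and \<sigma>: "finite_simple M \<sigma>" and \<sigma>0: "\<And>x. 0 \<le> \<sigma> x"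
    and int: "integrable M (\<lambda>x. \<sigma> x * cmod (g x))"
    and a: "a < (\<integral>\<^sup>+x. ennreal (\<sigma> x) * ennreal (cmod (g x)) \<partial>M)"
  shows "\<exists>\<psi>. finite_simple M \<psi> \<and> (\<forall>x. cmod (\<psi> x) \<le> \<sigma> x)
    \<and> a < ennreal (cmod (\<integral>x. g x * cnj (\<psi> x) \<partial>M))"
proof -
  have [measurable]: "\<sigma> \<in> borel_measurable M" by (rule finite_simple_measurable[OF \<sigma>])
  define I where "I = (\<integral>x. \<sigma> x * cmod (g x) \<partial>M)"
  have I: "(\<integral>\<^sup>+x. ennreal (\<sigma> x) * ennreal (cmod (g x)) \<partial>M) = ennreal I"
    unfolding I_def using \<sigma>0 by (subst nn_integral_eq_integral[OF int, symmetric]) (auto simp: ennreal_mult)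
  have "(\<lambda>x. sgn (g x)) \<in> borel_measurable M" by measurable
  from borel_measurable_implies_sequence_metric[OF this, of 0]
  obtain u where u: "\<And>i. simple_function M (u i)" "\<And>x. x \<in> space M \<Longrightarrow> (\<lambda>i. u i x) \<longlonglongrightarrow> sgn (g x)"
    by blast
  \<comment> \<open>Radial projection to the closed unit disc: it keeps the approximants simple,
    fixes the limit and gives the domination by \<sigma>.\<close>
  define e where "e i x = u i x /\<^sub>R max 1 (cmod (u i x))" for i x
  have e1: "cmod (e i x) \<le> 1" for i x
    by (simp add: e_def divide_simps max_def)
  have es: "simple_function M (e i)" for i unfolding e_def
    using simple_function_compose1[OF u(1)[of i], of "\<lambda>z. z /\<^sub>R max 1 (cmod z)"] by simp
  have [measurable]: "e i \<in> borel_measurable M" for i using es by (rule borel_measurable_simple_function)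
  have elim: "(\<lambda>i. e i x) \<longlonglongrightarrow> sgn (g x)" if "x \<in> space M" for x
  proof -
    have "(\<lambda>i. e i x) \<longlonglongrightarrow> sgn (g x) /\<^sub>R max 1 (cmod (sgn (g x)))"
      unfolding e_def by (intro tendsto_intros u that) auto
    then show ?thesis by (simp add: norm_sgn)
  qed
  define \<psi> where "\<psi> i x = of_real (\<sigma> x) * e i x" for i x
  have "simple_function M \<sigma>" using \<sigma> by (auto elim: simple_bochner_integrable.cases)
  then have "simple_function M (\<psi> i)" for i unfolding \<psi>_def
    using simple_function_compose2[OF _ es, of \<sigma> "\<lambda>x y. of_real x * y" i] by simp
  moreover have "emeasure M {y \<in> space M. \<psi> i y \<noteq> 0} \<noteq> \<infinity>" for i
  proof -
    have "emeasure M {y \<in> space M. \<psi> i y \<noteq> 0} \<le> emeasure M {y \<in> space M. \<sigma> y \<noteq> 0}"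
      by (intro emeasure_mono) (auto simp: \<psi>_def)
    then show ?thesis using \<sigma> by (auto elim!: simple_bochner_integrable.cases simp: top_unique)
  qed
  ultimately have \<psi>s: "finite_simple M (\<psi> i)" for i by (intro simple_bochner_integrable.intros)
  have \<psi>\<sigma>: "cmod (\<psi> i x) \<le> \<sigma> x" for i x
    using mult_left_mono[OF e1 \<sigma>0] \<sigma>0 by (simp add: \<psi>_def norm_mult)
  have [measurable]: "\<psi> i \<in> borel_measurable M" for i unfolding \<psi>_def by measurable
  have "(\<lambda>i. \<integral>x. g x * cnj (\<psi> i x) \<partial>M) \<longlonglongrightarrow> (\<integral>x. complex_of_real (\<sigma> x * cmod (g x)) \<partial>M)"
  proof (rule integral_dominated_convergence[OF _ _ int])
    show "AE x in M. (\<lambda>i. g x * cnj (\<psi> i x)) \<longlonglongrightarrow> complex_of_real (\<sigma> x * cmod (g x))"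
    proof (rule AE_I2)
      fix x assume x: "x \<in> space M"
      have "(\<lambda>i. g x * cnj (\<psi> i x)) \<longlonglongrightarrow> g x * cnj (of_real (\<sigma> x) * sgn (g x))"
        unfolding \<psi>_def by (intro tendsto_intros elim x)
      also have "g x * cnj (of_real (\<sigma> x) * sgn (g x)) = complex_of_real (\<sigma> x * cmod (g x))"
        by (cases "g x = 0") (auto simp: sgn_eq complex_norm_square[symmetric] power2_eq_square field_simps)
      finally show "(\<lambda>i. g x * cnj (\<psi> i x)) \<longlonglongrightarrow> complex_of_real (\<sigma> x * cmod (g x))" .
    qed
    show "AE x in M. norm (g x * cnj (\<psi> i x)) \<le> \<sigma> x * cmod (g x)" for i
      by (rule AE_I2) (simp add: norm_mult mult.commute[of "cmod (g _)"] mult_right_mono[OF \<psi>\<sigma>])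
  qed auto
  then have "(\<lambda>i. ennreal (cmod (\<integral>x. g x * cnj (\<psi> i x) \<partial>M))) \<longlonglongrightarrow> ennreal (cmod (complex_of_real I))"
    unfolding I_def integral_complex_of_real by (intro tendsto_ennrealI tendsto_norm)
  moreover have "0 \<le> I" unfolding I_def by (intro Bochner_Integration.integral_nonneg) (auto simp: \<sigma>0)
  ultimately have "(\<lambda>i. ennreal (cmod (\<integral>x. g x * cnj (\<psi> i x) \<partial>M))) \<longlonglongrightarrow> ennreal I" by simp
  from order_tendstoD(1)[OF this a[unfolded I]]
  obtain i where "a < ennreal (cmod (\<integral>x. g x * cnj (\<psi> i x) \<partial>M))"
    using eventually_happens'[OF trivial_limit_sequentially] by blast
  then show ?thesis using \<psi>s \<psi>\<sigma> by blast
qed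

section \<open>Square integrable functions and duality\<close>

lemma ennreal_powr_half_square: "(ennreal_powr x (1 / 2))\<^sup>2 = x"
  using ennreal_powr_inverse_powr[of 2 x] by (simp add: ennreal_powr_two)

lemma ennreal_power2_le_imp_le:
  fixes x y :: ennreal
  assumes "x\<^sup>2 \<le> y\<^sup>2"
  shows "x \<le> y"
proof -
  have e: "ennreal_powr (ennreal_powr z 2) (1 / 2) = z" for z
    by (rule ennreal_powr_powr_inverse) simp
  have "ennreal_powr (ennreal_powr x 2) (1 / 2) \<le> ennreal_powr (ennreal_powr y 2) (1 / 2)"
    by (rule ennreal_powr_mono) (use assms in \<open>simp_all add: ennreal_powr_two\<close>)
  then show ?thesis unfolding e .
qed

lemma Lp_norm_2_square: "(Lp_norm M 2 f)\<^sup>2 = (\<integral>\<^sup>+x. ennreal (cmod (f x)) ^ 2 \<partial>M)"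
  by (simp add: Lp_norm_def ennreal_Lp_norm_def ennreal_powr_half_square ennreal_powr_two
      del: ennreal_powr_ennreal)

lemma Lp_norm_1: "Lp_norm M 1 f = (\<integral>\<^sup>+x. ennreal (cmod (f x)) \<partial>M)"
proof -
  have "ennreal_powr x 1 = x" for x by (cases x) auto
  then show ?thesis by (simp add: Lp_norm_def ennreal_Lp_norm_def del: ennreal_powr_ennreal)
qed

lemma nn_integral_mult_le_Lp_norm_2:
  assumes [measurable]: "f \<in> borel_measurable M" "g \<in> borel_measurable M"
  shows "(\<integral>\<^sup>+x. ennreal (cmod (f x)) * ennreal (cmod (g x)) \<partial>M) \<le> Lp_norm M 2 f * Lp_norm M 2 g"
proof (rule ennreal_power2_le_imp_le)
  show "(\<integral>\<^sup>+x. ennreal (cmod (f x)) * ennreal (cmod (g x)) \<partial>M)\<^sup>2 \<le> (Lp_norm M 2 f * Lp_norm M 2 g)\<^sup>2"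
    unfolding power_mult_distrib Lp_norm_2_square by (rule Cauchy_Schwarz_nn_integral) measurable
qed

text \<open>For a function that is not integrable the left side is 0, the default value of the
  Bochner integral.\<close>

lemma norm_integral_le_nn_integral:
  fixes f :: "'a \<Rightarrow> complex"
  shows "ennreal (cmod (\<integral>x. f x \<partial>M)) \<le> (\<integral>\<^sup>+x. ennreal (cmod (f x)) \<partial>M)"
proof (cases "integrable M f")
  case True then show ?thesis by (rule integral_norm_bound_ennreal)
qed (simp add: not_integrable_integral_eq)

lemma norm_integral_le_Lp_norm_2:
  assumes [measurable]: "f \<in> borel_measurable M" "g \<in> borel_measurable M"
  shows "ennreal (cmod (\<integral>x. f x * cnj (g x) \<partial>M)) \<le> Lp_norm M 2 f * Lp_norm M 2 g"
proof -
  have "ennreal (cmod (\<integral>x. f x * cnj (g x) \<partial>M)) \<le> (\<integral>\<^sup>+x. ennreal (cmod (f x * cnj (g x))) \<partial>M)"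
    by (rule norm_integral_le_nn_integral)
  also have "\<dots> = (\<integral>\<^sup>+x. ennreal (cmod (f x)) * ennreal (cmod (g x)) \<partial>M)"
    by (simp add: norm_mult ennreal_mult)
  also have "\<dots> \<le> Lp_norm M 2 f * Lp_norm M 2 g" by (rule nn_integral_mult_le_Lp_norm_2) measurable
  finally show ?thesis .
qed

lemma Lp_space_measurable: "f \<in> Lp_space M p \<Longrightarrow> f \<in> borel_measurable M"
  by (simp add: Lp_space_def)

lemma integrable_mult_L2:
  assumes "f \<in> Lp_space M 2" "g \<in> Lp_space M 2"
  shows "integrable M (\<lambda>x. f x * cnj (g x))"
proof (rule integrableI_bounded)
  note [measurable] = assms[THEN Lp_space_measurable]
  show "(\<lambda>x. f x * cnj (g x)) \<in> borel_measurable M" by measurable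
  have "(\<integral>\<^sup>+x. ennreal (norm (f x * cnj (g x))) \<partial>M) = (\<integral>\<^sup>+x. ennreal (cmod (f x)) * ennreal (cmod (g x)) \<partial>M)"
    by (simp add: norm_mult ennreal_mult)
  also have "\<dots> \<le> Lp_norm M 2 f * Lp_norm M 2 g" by (rule nn_integral_mult_le_Lp_norm_2) measurable
  also have "\<dots> < \<infinity>" using assms by (simp add: Lp_space_def ennreal_mult_less_top)
  finally show "(\<integral>\<^sup>+x. ennreal (norm (f x * cnj (g x))) \<partial>M) < \<infinity>" .
qed

lemma finite_simple_nn_integral_finite:
  fixes f :: "'a \<Rightarrow> 'b::real_vector" and G :: "'b \<Rightarrow> real"
  assumes f: "finite_simple M f" and G: "G 0 = 0" "\<And>y. 0 \<le> G y"
  shows "(\<integral>\<^sup>+x. ennreal (G (f x)) \<partial>M) < \<infinity>"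
proof -
  have "finite_simple M (\<lambda>x. G (f x))"
    using simple_bochner_integrable_compose2[where p = "\<lambda>x y. G x", OF G(1) f f] .
  then have "(\<integral>\<^sup>+x. ennreal (G (f x)) \<partial>M) = ennreal (Bochner_Integration.simple_bochner_integral M (\<lambda>x. G (f x)))"
    using G by (simp add: simple_bochner_integral_eq_nn_integral)
  then show ?thesis by simp
qed

lemma finite_simple_Lp_1_2:
  assumes "finite_simple M f"
  shows "f \<in> Lp_space M 1" "f \<in> Lp_space M 2"
proof -
  have m: "f \<in> borel_measurable M" by (rule finite_simple_measurable[OF assms])
  show "f \<in> Lp_space M 1"
    using finite_simple_nn_integral_finite[OF assms, of cmod] m by (simp add: Lp_space_def Lp_norm_1)
  have "(\<integral>\<^sup>+x. ennreal ((cmod (f x))\<^sup>2) \<partial>M) < \<infinity>"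
    using finite_simple_nn_integral_finite[OF assms, of "\<lambda>z. (cmod z)\<^sup>2"] by simp
  then have "(Lp_norm M 2 f)\<^sup>2 < \<infinity>" by (simp add: Lp_norm_2_square ennreal_power)
  then have "Lp_norm M 2 f < \<infinity>" by (metis ennreal_top_eq_mult_iff infinity_ennreal_def less_top power2_eq_square zero_neq_one ennreal_top_mult top_neq_ennreal)
  then show "f \<in> Lp_space M 2" using m by (simp add: Lp_space_def)
qed

text \<open>Markov's inequality for the squared modulus. These level sets exhaust the points where f
  does not vanish and so supply the covering required by
  \<open>ennreal_Lp_norm_dual_witness\<close>.\<close>

lemma L2_finite_level:
  assumes f: "f \<in> Lp_space M 2"
  shows "emeasure M {x \<in> space M. 1 / (real n + 1) \<le> cmod (f x)} \<noteq> \<infinity>"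
proof -
  note [measurable] = f[THEN Lp_space_measurable]
  have "emeasure M {x \<in> space M. 1 / (real n + 1) \<le> cmod (f x)}
    \<le> emeasure M {x \<in> space M. 1 \<le> ennreal ((real n + 1)\<^sup>2) * ennreal (cmod (f x)) ^ 2}"
  proof (intro emeasure_mono)
    show "{x \<in> space M. 1 / (real n + 1) \<le> cmod (f x)} \<subseteq> {x \<in> space M. 1 \<le> ennreal ((real n + 1)\<^sup>2) * ennreal (cmod (f x)) ^ 2}"
    proof safe
      fix x assume "1 / (real n + 1) \<le> cmod (f x)"
      then have "1 \<le> (real n + 1) * cmod (f x)" by (simp add: field_simps)
      then have "1 \<le> ((real n + 1) * cmod (f x))\<^sup>2" by (rule one_le_power)
      then show "1 \<le> ennreal ((real n + 1)\<^sup>2) * ennreal (cmod (f x)) ^ 2"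
        by (simp add: ennreal_power ennreal_mult[symmetric] power_mult_distrib)
    qed
  qed measurable
  also have "\<dots> \<le> ennreal ((real n + 1)\<^sup>2) * (\<integral>\<^sup>+x. ennreal (cmod (f x)) ^ 2 * indicator (space M) x \<partial>M)"
    by (rule nn_integral_Markov_inequality) measurable
  also have "\<dots> = ennreal ((real n + 1)\<^sup>2) * (Lp_norm M 2 f)\<^sup>2"
    unfolding Lp_norm_2_square by (intro arg_cong2[where f = "(*)"] nn_integral_cong) auto
  also have "\<dots> < \<infinity>" using f by (simp add: Lp_space_def power2_eq_square ennreal_mult_less_top)
  finally show ?thesis by simp
qed

text \<open>The converse Hoelder inequality yields a simple \<sigma>; since g is in L^2,
  \<open>\<sigma> x * cmod (g x)\<close> is integrable, and a phase approximation makes \<sigma> a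
  complex test function. The other inequality is Hoelder; both sides may be infinite.\<close>

lemma Lp_norm_eq_SUP:
  assumes g: "g \<in> Lp_space M 2"
    and p: "1 < p" and q: "1 \<le> q" and pq: "1 / q + enn2real (1 / p) = 1"
  shows "Lp_norm M p g = (SUP \<psi>\<in>dual_ball M q. ennreal (cmod (\<integral>x. g x * cnj (\<psi> x) \<partial>M)))"
proof (rule antisym)
  note [measurable] = g[THEN Lp_space_measurable]
  show "Lp_norm M p g \<le> (SUP \<psi>\<in>dual_ball M q. ennreal (cmod (\<integral>x. g x * cnj (\<psi> x) \<partial>M)))"
  proof (rule dense_le)
    fix a assume a: "a < Lp_norm M p g"
    have "\<exists>\<sigma>::'a \<Rightarrow> real. finite_simple M \<sigma> \<and> (\<forall>x. 0 \<le> \<sigma> x)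
      \<and> (\<integral>\<^sup>+x. ennreal (\<sigma> x powr q) \<partial>M) \<le> 1 \<and> a < (\<integral>\<^sup>+x. ennreal (\<sigma> x) * ennreal (cmod (g x)) \<partial>M)"
    proof (rule ennreal_Lp_norm_dual_witness[OF _ _ _ _ p q pq a[unfolded Lp_norm_def]])
      show "emeasure M {x \<in> space M. 1 / (real n + 1) \<le> cmod (g x)} \<noteq> \<infinity>" for n
        by (rule L2_finite_level[OF g])
      fix x assume "x \<in> space M" "ennreal (cmod (g x)) \<noteq> 0"
      then have "0 < cmod (g x)" by simp
      then obtain n where "inverse (real (Suc n)) < cmod (g x)" using reals_Archimedean by blast
      then show "x \<in> (\<Union>n. {x \<in> space M. 1 / (real n + 1) \<le> cmod (g x)})"
        using \<open>x \<in> space M\<close> by (auto intro!: exI[of _ n] simp: inverse_eq_divide add.commute)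
    qed measurable
    then obtain \<sigma> :: "'a \<Rightarrow> real" where \<sigma>: "finite_simple M \<sigma>" "\<And>x. 0 \<le> \<sigma> x"
      "(\<integral>\<^sup>+x. ennreal (\<sigma> x powr q) \<partial>M) \<le> 1" "a < (\<integral>\<^sup>+x. ennreal (\<sigma> x) * ennreal (cmod (g x)) \<partial>M)"
      by blast
    have "finite_simple M (\<lambda>x. complex_of_real (\<sigma> x))"
      using simple_bochner_integrable_compose2[where p = "\<lambda>x y. complex_of_real x", OF _ \<sigma>(1) \<sigma>(1)] by simp
    then have "integrable M (\<lambda>x. complex_of_real (\<sigma> x) * cnj (g x))"
      by (intro integrable_mult_L2 finite_simple_Lp_1_2(2) g)
    from integrable_norm[OF this] have "integrable M (\<lambda>x. \<sigma> x * cmod (g x))"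
      using \<sigma>(2) by (simp add: norm_mult)
    from phase_approximation[OF _ \<sigma>(1,2) this \<sigma>(4)]
    obtain \<psi> where \<psi>: "finite_simple M \<psi>" "\<And>x. cmod (\<psi> x) \<le> \<sigma> x"
      "a < ennreal (cmod (\<integral>x. g x * cnj (\<psi> x) \<partial>M))" by auto
    have "(\<integral>\<^sup>+x. ennreal (cmod (\<psi> x) powr q) \<partial>M) \<le> (\<integral>\<^sup>+x. ennreal (\<sigma> x powr q) \<partial>M)"
      using q \<psi>(2) by (intro nn_integral_mono ennreal_leI powr_mono2) auto
    with \<sigma>(3) \<psi>(1) have "\<psi> \<in> dual_ball M q" by (simp add: dual_ball_def)
    then show "a \<le> (SUP \<psi>\<in>dual_ball M q. ennreal (cmod (\<integral>x. g x * cnj (\<psi> x) \<partial>M)))"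
      by (rule SUP_upper2) (use \<psi>(3) in simp)
  qed
  show "(SUP \<psi>\<in>dual_ball M q. ennreal (cmod (\<integral>x. g x * cnj (\<psi> x) \<partial>M))) \<le> Lp_norm M p g"
  proof (rule SUP_least)
    fix \<psi> assume "\<psi> \<in> dual_ball M q"
    then have \<psi>: "finite_simple M \<psi>" "(\<integral>\<^sup>+x. ennreal (cmod (\<psi> x) powr q) \<partial>M) \<le> 1"
      by (auto simp: dual_ball_def)
    note [measurable] = finite_simple_measurable[OF \<psi>(1)]
    have "ennreal (cmod (\<integral>x. g x * cnj (\<psi> x) \<partial>M)) \<le> (\<integral>\<^sup>+x. ennreal (cmod (g x * cnj (\<psi> x))) \<partial>M)"
      by (rule norm_integral_le_nn_integral)
    also have "\<dots> = (\<integral>\<^sup>+x. ennreal (cmod (\<psi> x)) * ennreal (cmod (g x)) \<partial>M)"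
      by (simp add: norm_mult ennreal_mult mult.commute)
    also have "\<dots> \<le> Lp_norm M p g" unfolding Lp_norm_def
      by (rule ennreal_Lp_norm_hoelder[OF _ _ _ p q pq]) (use \<psi>(2) in auto)
    finally show "ennreal (cmod (\<integral>x. g x * cnj (\<psi> x) \<partial>M)) \<le> Lp_norm M p g" .
  qed
qed

section \<open>Lebesgue measurability of functions known almost everywhere\<close>

lemma measurable_lebesgue_AE_cong:
  assumes g: "g \<in> measurable lebesgue N" and ae: "AE t in lebesgue. f t = g t"
    and f: "\<And>t. f t \<in> space N"
  shows "f \<in> measurable lebesgue N"
proof (rule measurableI)
  fix A assume A: "A \<in> sets N"
  show "f -` A \<inter> space lebesgue \<in> sets lebesgue"
  proof (rule completion.in_sets_AE)
    show "AE t in lebesgue. t \<in> g -` A \<inter> space lebesgue \<longleftrightarrow> t \<in> f -` A \<inter> space lebesgue"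
      using ae by eventually_elim simp
  qed (use measurable_sets[OF g A] in auto)
qed (use f in simp)

lemma AE_limit_measurable_lebesgue:
  fixes f :: "nat \<Rightarrow> 'a::euclidean_space \<Rightarrow> 'b::metric_space"
  assumes f: "\<And>n. f n \<in> borel_measurable lebesgue"
    and lim: "AE t in lebesgue. (\<lambda>n. f n t) \<longlonglongrightarrow> g t"
  shows "g \<in> borel_measurable lebesgue"
proof -
  obtain N where N: "N \<in> null_sets lebesgue" "{t \<in> space lebesgue. \<not> (\<lambda>n. f n t) \<longlonglongrightarrow> g t} \<subseteq> N"
    by (rule AE_E3[OF lim]) auto
  have Ns: "N \<in> sets lebesgue" using N(1) by auto
  \<comment> \<open>On the null set N any constant will do; the type is only a metric space, so the
    constant is an arbitrary choice.\<close>
  define c where "c = (SOME x::'b. True)"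
  define h where "h t = (if t \<in> N then c else g t)" for t
  have "h \<in> borel_measurable lebesgue"
  proof (rule borel_measurable_LIMSEQ_metric)
    show "(\<lambda>t. if t \<in> N then c else f n t) \<in> borel_measurable lebesgue" for n
      using f Ns by (intro measurable_If_set) auto
    show "(\<lambda>n. if t \<in> N then c else f n t) \<longlonglongrightarrow> h t" for t
      using N(2) by (auto simp: h_def)
  qed
  moreover have "AE t in lebesgue. g t = h t"
    using AE_not_in[OF N(1)] by eventually_elim (simp add: h_def)
  ultimately show ?thesis by (rule measurable_lebesgue_AE_cong) simp
qed

section \<open>Countable norming families\<close>

definition pairing :: "'a measure \<Rightarrow> ('a \<Rightarrow> complex) \<Rightarrow> ('a \<Rightarrow> complex) \<Rightarrow> complex" where
  "pairing M f g = (\<integral>x. f x * cnj (g x) \<partial>M)"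

lemma pairing_diff_le:
  assumes "f \<in> Lp_space M 2" "g \<in> Lp_space M 2" "\<psi> \<in> Lp_space M 2"
  shows "ennreal (cmod (pairing M f \<psi> - pairing M g \<psi>)) \<le> Lp_norm M 2 (\<lambda>x. f x - g x) * Lp_norm M 2 \<psi>"
proof -
  note [measurable] = assms[THEN Lp_space_measurable]
  have "pairing M f \<psi> - pairing M g \<psi> = (\<integral>x. (f x - g x) * cnj (\<psi> x) \<partial>M)"
    unfolding pairing_def using assms
    by (subst Bochner_Integration.integral_diff[symmetric]) (auto simp: integrable_mult_L2 algebra_simps)
  then show ?thesis by (simp add: norm_integral_le_Lp_norm_2)
qed

lemma zero_in_dual_ball: "(\<lambda>x. 0) \<in> dual_ball M q"
  by (auto simp: dual_ball_def intro!: simple_bochner_integrable.intros)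

lemma dual_ball_L2: "\<psi> \<in> dual_ball M q \<Longrightarrow> \<psi> \<in> Lp_space M 2"
  by (simp add: dual_ball_def finite_simple_Lp_1_2)

text \<open>Pairing with a fixed \<psi> is Lipschitz for the L^2 norm, so it maps the simple
  approximants of u to simple scalar functions that converge almost everywhere.\<close>

lemma measurable_pairing:
  assumes u: "strongly_measurable_L2 M u" "\<And>t. u t \<in> Lp_space M 2" and \<psi>: "\<psi> \<in> Lp_space M 2"
  shows "(\<lambda>t. pairing M (u t) \<psi>) \<in> borel_measurable lebesgue"
proof -
  obtain s where s: "\<And>n. simple_function lebesgue (s n)" "\<And>n t. s n t \<in> Lp_space M 2"
    "AE t in lebesgue. (\<lambda>n. Lp_norm M 2 (\<lambda>x. s n t x - u t x)) \<longlonglongrightarrow> 0"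
    using u(1) unfolding strongly_measurable_L2_def by blast
  show ?thesis
  proof (rule AE_limit_measurable_lebesgue)
    show "(\<lambda>t. pairing M (s n t) \<psi>) \<in> borel_measurable lebesgue" for n
      by (intro borel_measurable_simple_function simple_function_compose1[OF s(1)])
    show "AE t in lebesgue. (\<lambda>n. pairing M (s n t) \<psi>) \<longlonglongrightarrow> pairing M (u t) \<psi>"
      using s(3)
    proof eventually_elim
      case (elim t)
      \<comment> \<open>Finiteness matters here: multiplication on \<open>ennreal\<close> is not
        continuous where 0 meets \<infinity>.\<close>
      have fin: "Lp_norm M 2 \<psi> < top" using \<psi> by (simp add: Lp_space_def)
      have "(\<lambda>n. Lp_norm M 2 (\<lambda>x. s n t x - u t x) * Lp_norm M 2 \<psi>) \<longlonglongrightarrow> 0 * Lp_norm M 2 \<psi>"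
        using fin by (intro tendsto_mult_ennreal elim tendsto_const) auto
      then have "(\<lambda>n. ennreal (cmod (pairing M (s n t) \<psi> - pairing M (u t) \<psi>))) \<longlonglongrightarrow> 0"
        unfolding mult_zero_left
        by (rule tendsto_sandwich[OF always_eventually always_eventually tendsto_const, rotated -1])
          (auto intro: pairing_diff_le s(2) u(2) \<psi>)
      then have "(\<lambda>n. cmod (pairing M (s n t) \<psi> - pairing M (u t) \<psi>)) \<longlonglongrightarrow> 0"
        using tendsto_ennreal_iff[of "\<lambda>n. cmod (pairing M (s n t) \<psi> - pairing M (u t) \<psi>)" sequentially 0] by simp
      from LIM_zero_cancel[OF tendsto_norm_zero_cancel[OF this]] show ?case .
    qed
  qed
qed

text \<open>The approximants \<open>s n\<close> of \<open>u\<close> take countably many values, and for each of them a countable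
  family norms the part of the ball where the \<open>L\<^sup>2\<close> norm is at most \<open>m\<close>.\<close>

lemma countable_norming:
  assumes u: "strongly_measurable_L2 M u" "\<And>t. u t \<in> Lp_space M 2"
  shows "\<exists>\<psi>::nat \<Rightarrow> 'a \<Rightarrow> complex. (\<forall>k. \<psi> k \<in> dual_ball M q) \<and>
    (AE t in lebesgue. (SUP \<phi>\<in>dual_ball M q. ennreal (cmod (pairing M (u t) \<phi>)))
       = (SUP k. ennreal (cmod (pairing M (u t) (\<psi> k)))))"
proof -
  obtain s where s: "\<And>n. simple_function lebesgue (s n)" "\<And>n t. s n t \<in> Lp_space M 2"
    "AE t in lebesgue. (\<lambda>n. Lp_norm M 2 (\<lambda>x. s n t x - u t x)) \<longlonglongrightarrow> 0"
    using u(1) unfolding strongly_measurable_L2_def by blast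
  define D where "D = (\<Union>n. range (s n))"
  have "finite (range (s n))" for n using simple_functionD(1)[OF s(1)[of n]] by simp
  then have "countable D" unfolding D_def by (auto intro: countable_finite)
  \<comment> \<open>The dual ball is bounded in L^q, but in general not in L^2. Cutting it by the
    L^2 norm makes the pairings with \<open>s n t\<close> converge to those with \<open>u t\<close>
    uniformly on each piece.\<close>
  define P where "P m = {\<psi> \<in> dual_ball M q. Lp_norm M 2 \<psi> \<le> of_nat m}" for m :: nat
  have "\<exists>Y::nat \<Rightarrow> 'a \<Rightarrow> complex. (\<forall>i. Y i \<in> P m) \<and>
      (SUP \<phi>\<in>P m. ennreal (cmod (pairing M d \<phi>))) = (SUP i. ennreal (cmod (pairing M d (Y i))))" for d m
  proof -
    have "(\<lambda>x. 0) \<in> P m"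
      by (simp add: P_def zero_in_dual_ball) (simp add: Lp_norm_def ennreal_Lp_norm_def)
    then have "P m \<noteq> {}" by blast
    from ennreal_SUP_countable_SUP[OF this, of "\<lambda>\<phi>. ennreal (cmod (pairing M d \<phi>))"]
    obtain f :: "nat \<Rightarrow> ennreal" where f: "range f \<subseteq> (\<lambda>\<phi>. ennreal (cmod (pairing M d \<phi>))) ` P m"
      "(SUP \<phi>\<in>P m. ennreal (cmod (pairing M d \<phi>))) = (SUP i. f i)" by blast
    from f(1) have "\<forall>i. \<exists>\<phi>. \<phi> \<in> P m \<and> f i = ennreal (cmod (pairing M d \<phi>))" by blast
    then obtain Y where "\<And>i. Y i \<in> P m" "\<And>i. f i = ennreal (cmod (pairing M d (Y i)))" by metis
    then show ?thesis using f(2) by auto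
  qed
  then have "\<forall>d. \<exists>Y::nat \<Rightarrow> nat \<Rightarrow> 'a \<Rightarrow> complex. \<forall>m. (\<forall>i. Y m i \<in> P m) \<and>
      (SUP \<phi>\<in>P m. ennreal (cmod (pairing M d \<phi>))) = (SUP i. ennreal (cmod (pairing M d (Y m i))))"
    by (intro allI choice)
  from choice[OF this] obtain Y :: "('a \<Rightarrow> complex) \<Rightarrow> nat \<Rightarrow> nat \<Rightarrow> 'a \<Rightarrow> complex" where
    "\<forall>d m. (\<forall>i. Y d m i \<in> P m) \<and>
      (SUP \<phi>\<in>P m. ennreal (cmod (pairing M d \<phi>))) = (SUP i. ennreal (cmod (pairing M d (Y d m i))))" ..
  then have Y: "\<And>d m i. Y d m i \<in> P m"
    "\<And>d m. (SUP \<phi>\<in>P m. ennreal (cmod (pairing M d \<phi>))) = (SUP i. ennreal (cmod (pairing M d (Y d m i))))"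
    by blast+
  define P0 where "P0 = (\<Union>d\<in>D. \<Union>m. range (Y d m))"
  have "countable P0" unfolding P0_def using \<open>countable D\<close> by (intro countable_UN) auto
  moreover have "P0 \<noteq> {}" by (auto simp: P0_def D_def)
  ultimately have ran: "range (from_nat_into P0) = P0" by (intro range_from_nat_into)
  have P0: "P0 \<subseteq> dual_ball M q" using Y(1) by (auto simp: P0_def P_def)
  have "(SUP \<phi>\<in>dual_ball M q. ennreal (cmod (pairing M (u t) \<phi>)))
       = (SUP \<phi>\<in>P0. ennreal (cmod (pairing M (u t) \<phi>)))"
    if lim: "(\<lambda>n. Lp_norm M 2 (\<lambda>x. s n t x - u t x)) \<longlonglongrightarrow> 0" for t
  proof (rule antisym)
    let ?N = "\<lambda>\<phi>. ennreal (cmod (pairing M (u t) \<phi>))"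
    let ?e = "\<lambda>n. Lp_norm M 2 (\<lambda>x. s n t x - u t x)"
    show "(SUP \<phi>\<in>P0. ?N \<phi>) \<le> (SUP \<phi>\<in>dual_ball M q. ?N \<phi>)"
      using P0 by (rule SUP_subset_mono) simp
    show "(SUP \<phi>\<in>dual_ball M q. ?N \<phi>) \<le> (SUP \<phi>\<in>P0. ?N \<phi>)"
    proof (rule SUP_least)
      fix \<phi> assume \<phi>: "\<phi> \<in> dual_ball M q"
      have "Lp_norm M 2 \<phi> < top" using dual_ball_L2[OF \<phi>] by (simp add: Lp_space_def)
      then obtain c where c: "0 \<le> c" "Lp_norm M 2 \<phi> = ennreal c" by (cases "Lp_norm M 2 \<phi>") auto
      define m where "m = nat \<lceil>c\<rceil>"
      have "\<phi> \<in> P m" using \<phi> c by (simp add: P_def m_def ennreal_of_nat_eq_real_of_nat ennreal_leI)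
      have close: "ennreal (cmod (pairing M (u t) \<eta>)) \<le> ennreal (cmod (pairing M (s n t) \<eta>)) + ?e n * of_nat m"
        "ennreal (cmod (pairing M (s n t) \<eta>)) \<le> ennreal (cmod (pairing M (u t) \<eta>)) + ?e n * of_nat m"
        if "\<eta> \<in> P m" for n \<eta>
      proof -
        have \<eta>: "\<eta> \<in> Lp_space M 2" "Lp_norm M 2 \<eta> \<le> of_nat m" using that dual_ball_L2 by (auto simp: P_def)
        have "ennreal (cmod (pairing M (s n t) \<eta> - pairing M (u t) \<eta>)) \<le> ?e n * Lp_norm M 2 \<eta>"
          by (rule pairing_diff_le[OF s(2) u(2) \<eta>(1)])
        also have "\<dots> \<le> ?e n * of_nat m" by (intro mult_left_mono \<eta>) simp
        finally have d: "ennreal (cmod (pairing M (s n t) \<eta> - pairing M (u t) \<eta>)) \<le> ?e n * of_nat m" .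
        have "cmod (pairing M (u t) \<eta>) \<le> cmod (pairing M (s n t) \<eta>) + cmod (pairing M (s n t) \<eta> - pairing M (u t) \<eta>)"
          by (metis norm_minus_commute norm_triangle_sub)
        from ennreal_leI[OF this] d
        show "ennreal (cmod (pairing M (u t) \<eta>)) \<le> ennreal (cmod (pairing M (s n t) \<eta>)) + ?e n * of_nat m"
          by (simp add: order_trans[OF _ add_left_mono])
        have "cmod (pairing M (s n t) \<eta>) \<le> cmod (pairing M (u t) \<eta>) + cmod (pairing M (s n t) \<eta> - pairing M (u t) \<eta>)"
          by (metis norm_triangle_sub)
        from ennreal_leI[OF this] d
        show "ennreal (cmod (pairing M (s n t) \<eta>)) \<le> ennreal (cmod (pairing M (u t) \<eta>)) + ?e n * of_nat m"
          by (simp add: order_trans[OF _ add_left_mono])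
      qed
      \<comment> \<open>One error term is for passing from \<open>u t\<close> to the approximant,
        for which the family Y is norming, and one for returning to \<open>u t\<close>.\<close>
      have bound: "?N \<phi> \<le> (SUP \<phi>\<in>P0. ?N \<phi>) + 2 * (?e n * of_nat m)" for n
      proof -
        have "?N \<phi> \<le> ennreal (cmod (pairing M (s n t) \<phi>)) + ?e n * of_nat m" by (rule close(1)[OF \<open>\<phi> \<in> P m\<close>])
        also have "ennreal (cmod (pairing M (s n t) \<phi>)) \<le> (SUP i. ennreal (cmod (pairing M (s n t) (Y (s n t) m i))))"
          unfolding Y(2)[symmetric] using \<open>\<phi> \<in> P m\<close> by (rule SUP_upper)
        also have "\<dots> \<le> (SUP \<phi>\<in>P0. ?N \<phi>) + ?e n * of_nat m"
        proof (rule SUP_least)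
          fix i
          have "Y (s n t) m i \<in> P0" unfolding P0_def D_def by blast
          then have "?N (Y (s n t) m i) \<le> (SUP \<phi>\<in>P0. ?N \<phi>)" by (rule SUP_upper)
          with close(2)[OF Y(1)[where i = i], of n "s n t"] 
          show "ennreal (cmod (pairing M (s n t) (Y (s n t) m i))) \<le> (SUP \<phi>\<in>P0. ?N \<phi>) + ?e n * of_nat m"
            by (meson add_right_mono order_trans)
        qed
        finally show ?thesis by (simp add: mult_2 add.assoc add_right_mono)
      qed
      have "(\<lambda>n. (SUP \<phi>\<in>P0. ?N \<phi>) + 2 * (?e n * of_nat m)) \<longlonglongrightarrow> (SUP \<phi>\<in>P0. ?N \<phi>) + 2 * (0 * of_nat m)"
        by (intro tendsto_intros tendsto_mult_ennreal lim) (auto simp: ennreal_of_nat_eq_real_of_nat)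
      then have "(\<lambda>n. (SUP \<phi>\<in>P0. ?N \<phi>) + 2 * (?e n * of_nat m)) \<longlonglongrightarrow> (SUP \<phi>\<in>P0. ?N \<phi>)" by simp
      then show "?N \<phi> \<le> (SUP \<phi>\<in>P0. ?N \<phi>)" by (rule LIMSEQ_le_const) (use bound in blast)
    qed
  qed
  then have "AE t in lebesgue. (SUP \<phi>\<in>dual_ball M q. ennreal (cmod (pairing M (u t) \<phi>)))
       = (SUP \<phi>\<in>range (from_nat_into P0). ennreal (cmod (pairing M (u t) \<phi>)))"
    unfolding ran using s(3) by (auto elim!: eventually_mono)
  moreover have "from_nat_into P0 k \<in> dual_ball M q" for k using P0 ran by blast
  ultimately show ?thesis by (intro exI[of _ "from_nat_into P0"] conjI allI) (simp_all add: image_image)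
qed

section \<open>Interpolation between the two estimates\<close>

lemma ennreal_power2_eq_imp_eq:
  fixes x y :: ennreal
  assumes "x\<^sup>2 = y\<^sup>2"
  shows "x = y"
proof (rule antisym)
  show "x \<le> y" by (rule ennreal_power2_le_imp_le) (simp only: assms order_refl)
  show "y \<le> x" by (rule ennreal_power2_le_imp_le) (simp only: assms order_refl)
qed

text \<open>Coefficients are separated from the sets: with the sets fixed, simple functions become
  coefficient vectors and the operator becomes a finite matrix, on which the interpolation is
  done.\<close>

definition step_fun :: "'i set \<Rightarrow> ('i \<Rightarrow> 'a set) \<Rightarrow> ('i \<Rightarrow> complex) \<Rightarrow> 'a \<Rightarrow> complex" where
  "step_fun I S x = (\<lambda>y. \<Sum>i\<in>I. x i * indicator (S i) y)"

lemma step_fun_disjoint: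
  assumes "finite I" "disjoint_family_on S I" "G 0 = (0::real)"
  shows "G (step_fun I S x y) = (\<Sum>i\<in>I. G (x i) * indicator (S i) y)"
proof (cases "\<exists>i\<in>I. y \<in> S i")
  case True
  then obtain i where i: "i \<in> I" "y \<in> S i" by blast
  have y: "y \<in> S j \<longleftrightarrow> j = i" if "j \<in> I" for j
    using disjoint_family_onD[OF assms(2) that i(1)] i(2) by blast
  have "step_fun I S x y = (\<Sum>j\<in>I. if j = i then x j else 0)"
    unfolding step_fun_def by (intro sum.cong) (auto simp: y)
  moreover have "(\<Sum>j\<in>I. G (x j) * indicator (S j) y) = (\<Sum>j\<in>I. if j = i then G (x j) else 0)"
    by (intro sum.cong) (auto simp: y)
  ultimately show ?thesis using i(1) assms(1) by simp
next
  case False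
  then show ?thesis using assms(3) by (simp add: step_fun_def)
qed

lemma nn_integral_step_fun:
  assumes I: "finite I" "disjoint_family_on S I" and S: "\<And>i. i \<in> I \<Longrightarrow> S i \<in> fmeasurable M"
    and G: "G 0 = 0" "\<And>z. 0 \<le> G z"
  shows "(\<integral>\<^sup>+y. ennreal (G (step_fun I S x y)) \<partial>M) = ennreal (\<Sum>i\<in>I. G (x i) * measure M (S i))"
proof -
  have [measurable]: "S i \<in> sets M" if "i \<in> I" for i using S[OF that] by (rule fmeasurableD)
  have "(\<integral>\<^sup>+y. ennreal (G (step_fun I S x y)) \<partial>M) = (\<integral>\<^sup>+y. (\<Sum>i\<in>I. ennreal (G (x i)) * indicator (S i) y) \<partial>M)"
    unfolding step_fun_disjoint[of I S G, OF I G(1)] using G(2)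
    by (simp add: sum_ennreal[symmetric] ennreal_mult ennreal_indicator)
  also have "\<dots> = (\<Sum>i\<in>I. ennreal (G (x i)) * emeasure M (S i))"
    by (subst nn_integral_sum) (auto simp: nn_integral_cmult_indicator)
  also have "\<dots> = (\<Sum>i\<in>I. ennreal (G (x i) * measure M (S i)))"
    using S G(2) by (intro sum.cong) (auto simp: ennreal_mult emeasure_eq_measure2)
  also have "\<dots> = ennreal (\<Sum>i\<in>I. G (x i) * measure M (S i))"
    using G(2) by (intro sum_ennreal) auto
  finally show ?thesis .
qed

lemma Lp_norm_1_step_fun:
  assumes "finite I" "disjoint_family_on S I" "\<And>i. i \<in> I \<Longrightarrow> S i \<in> fmeasurable M"
  shows "Lp_norm M 1 (step_fun I S x) = ennreal (\<Sum>i\<in>I. cmod (x i) * measure M (S i))"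
  unfolding Lp_norm_1 by (rule nn_integral_step_fun[OF assms]) auto

lemma Lp_norm_2_step_fun:
  assumes "finite I" "disjoint_family_on S I" "\<And>i. i \<in> I \<Longrightarrow> S i \<in> fmeasurable M"
  shows "Lp_norm M 2 (step_fun I S x) = ennreal (sqrt (\<Sum>i\<in>I. (cmod (x i))\<^sup>2 * measure M (S i)))"
proof -
  have nn: "0 \<le> (\<Sum>i\<in>I. (cmod (x i))\<^sup>2 * measure M (S i))" by (intro sum_nonneg) auto
  have "(Lp_norm M 2 (step_fun I S x))\<^sup>2 = (\<integral>\<^sup>+y. ennreal ((cmod (step_fun I S x y))\<^sup>2) \<partial>M)"
    by (simp add: Lp_norm_2_square ennreal_power)
  also have "\<dots> = ennreal (\<Sum>i\<in>I. (cmod (x i))\<^sup>2 * measure M (S i))"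
    by (rule nn_integral_step_fun[OF assms, where G = "\<lambda>z. (cmod z)\<^sup>2"]) auto
  also have "\<dots> = (ennreal (sqrt (\<Sum>i\<in>I. (cmod (x i))\<^sup>2 * measure M (S i))))\<^sup>2"
    using nn by (simp add: ennreal_power)
  finally show ?thesis by (rule ennreal_power2_eq_imp_eq)
qed

lemma finite_simple_step_fun:
  assumes I: "finite I" "disjoint_family_on S I" and S: "\<And>i. i \<in> I \<Longrightarrow> S i \<in> fmeasurable M"
  shows "finite_simple M (step_fun I S x)"
proof (rule simple_bochner_integrableI_bounded)
  show "simple_function M (step_fun I S x)" unfolding step_fun_def
    using S by (intro simple_function_sum simple_function_mult simple_function_const simple_function_indicator) auto
  show "(\<integral>\<^sup>+y. ennreal (norm (step_fun I S x y)) \<partial>M) < \<infinity>"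
    using Lp_norm_1_step_fun[OF assms, of x] by (simp add: Lp_norm_1)
qed

text \<open>Level set decomposition. The value 0 is left out, so that all level sets have finite
  measure and all coefficients are nonzero, as \<open>riesz_thorin_matrix\<close> requires.\<close>

lemma finite_simple_step_fun_eq:
  assumes \<psi>: "finite_simple M \<psi>"
  defines "V \<equiv> \<psi> ` space M - {0}" and "S \<equiv> \<lambda>v. {y \<in> space M. \<psi> y = v}"
  shows "finite V" "disjoint_family_on S V" "\<And>v. v \<in> V \<Longrightarrow> S v \<in> fmeasurable M"
    "\<And>y. y \<in> space M \<Longrightarrow> step_fun V S (\<lambda>v. v) y = \<psi> y"
proof -
  have sf: "simple_function M \<psi>" and fin: "emeasure M {y \<in> space M. \<psi> y \<noteq> 0} \<noteq> \<infinity>"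
    using \<psi> by (auto elim: simple_bochner_integrable.cases)
  note [measurable] = finite_simple_measurable[OF \<psi>]
  show "finite V" unfolding V_def using simple_functionD(1)[OF sf] by simp
  show "disjoint_family_on S V" by (auto simp: disjoint_family_on_def S_def)
  show "S v \<in> fmeasurable M" if "v \<in> V" for v
  proof (rule fmeasurableI)
    have "emeasure M (S v) \<le> emeasure M {y \<in> space M. \<psi> y \<noteq> 0}"
      using that by (intro emeasure_mono) (auto simp: S_def V_def)
    then show "emeasure M (S v) < \<infinity>" using fin by (auto simp: less_top top_unique)
    show "S v \<in> sets M" unfolding S_def by measurable
  qed
  show "step_fun V S (\<lambda>v. v) y = \<psi> y" if "y \<in> space M" for y
  proof -
    have "step_fun V S (\<lambda>v. v) y = (\<Sum>v\<in>V. if v = \<psi> y then v else 0)"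
      unfolding step_fun_def using that by (intro sum.cong) (auto simp: S_def)
    also have "\<dots> = \<psi> y" using that \<open>finite V\<close> by (auto simp: V_def)
    finally show ?thesis .
  qed
qed

lemma adjoint_pairing:
  "is_adjoint_L2 M A B \<Longrightarrow> g \<in> Lp_space M 2 \<Longrightarrow> pairing M (A f) g = cinner f (B g)"
  by (simp add: is_adjoint_L2_def pairing_def)

text \<open>The decomposition into level sets reproduces a simple function only on the space of M.
  The adjoint sees nothing but pairings, so it takes the same value on both.\<close>

lemma adjoint_cong:
  assumes "is_adjoint_L2 M A B" "g \<in> Lp_space M 2" "g' \<in> Lp_space M 2" "\<And>y. y \<in> space M \<Longrightarrow> g y = g' y"
  shows "B g = B g'"
proof (rule cinner_eqI)
  fix f
  have "pairing M (A f) g = pairing M (A f) g'"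
    unfolding pairing_def using assms(4) by (intro Bochner_Integration.integral_cong) auto
  then show "cinner f (B g) = cinner f (B g')" using assms by (simp add: adjoint_pairing)
qed

lemma cinner_sum_right: "cinner x (\<Sum>i\<in>I. f i) = (\<Sum>i\<in>I. cinner (x::'h::complex_hilbert_space) (f i))"
  by (induction I rule: infinite_finite_induct) (auto simp: cinner_add_right)

lemma cinner_sum_left: "cinner (\<Sum>i\<in>I. f i) (x::'h::complex_hilbert_space) = (\<Sum>i\<in>I. cinner (f i) x)"
  by (induction I rule: infinite_finite_induct) (auto simp: cinner_add_left)

text \<open>Linearity of the adjoint is not part of \<open>is_adjoint_L2\<close>. It follows by
  testing against every f: the conjugate in the pairing matches the antilinearity of
  \<open>cinner\<close> in its second argument.\<close>

lemma adjoint_step_fun: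
  fixes B :: "('a \<Rightarrow> complex) \<Rightarrow> 'h::complex_hilbert_space"
  assumes adj: "is_adjoint_L2 M A B" and A: "\<And>f. A f \<in> Lp_space M 2"
    and I: "finite I" "disjoint_family_on S I" and S: "\<And>i. i \<in> I \<Longrightarrow> S i \<in> fmeasurable M"
  shows "B (step_fun I S x) = (\<Sum>i\<in>I. scaleC (x i) (B (indicator (S i))))"
proof (rule cinner_eqI)
  fix f
  have ind: "(indicator (S i) :: 'a \<Rightarrow> complex) \<in> Lp_space M 2" if "i \<in> I" for i
  proof -
    have "step_fun {i} S (\<lambda>_. 1) = indicator (S i)" by (auto simp: step_fun_def)
    moreover have "finite_simple M (step_fun {i} S (\<lambda>_. 1))"
      using S that by (intro finite_simple_step_fun) (auto simp: disjoint_family_on_def)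
    ultimately show ?thesis using finite_simple_Lp_1_2(2) by metis
  qed
  have "cinner f (B (step_fun I S x)) = pairing M (A f) (step_fun I S x)"
    by (intro adjoint_pairing[OF adj, symmetric] finite_simple_Lp_1_2 finite_simple_step_fun I S)
  also have "\<dots> = (\<integral>y. (\<Sum>i\<in>I. cnj (x i) * (A f y * cnj (indicator (S i) y))) \<partial>M)"
    unfolding pairing_def step_fun_def by (simp add: sum_distrib_left mult_ac)
  also have "\<dots> = (\<Sum>i\<in>I. \<integral>y. cnj (x i) * (A f y * cnj (indicator (S i) y)) \<partial>M)"
    by (rule Bochner_Integration.integral_sum) (intro integrable_mult_right integrable_mult_L2 A ind)
  also have "\<dots> = (\<Sum>i\<in>I. cnj (x i) * cinner f (B (indicator (S i))))"
    using adjoint_pairing[OF adj ind] by (simp add: pairing_def)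
  also have "\<dots> = cinner f (\<Sum>i\<in>I. scaleC (x i) (B (indicator (S i))))"
    by (simp add: cinner_sum_right cinner_scaleC_right)
  finally show "cinner f (B (step_fun I S x)) = \<dots>" .
qed

text \<open>One pair of times: \<open>A1\<close> and \<open>A2\<close> stand for W(s) and W(t),
  \<open>B1\<close> and \<open>B2\<close> for their adjoints. The numbers a and b absorb all powers
  of h and of h + |t - s|.\<close>

locale TT_star_bounds =
  fixes M :: "'a measure" and A1 A2 :: "'h::complex_hilbert_space \<Rightarrow> 'a \<Rightarrow> complex"
    and B1 B2 :: "('a \<Rightarrow> complex) \<Rightarrow> 'h" and a b :: real
  assumes A1: "\<And>f. A1 f \<in> Lp_space M 2" and A2: "\<And>f. A2 f \<in> Lp_space M 2"
    and adj1: "is_adjoint_L2 M A1 B1" and adj2: "is_adjoint_L2 M A2 B2"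
    and ab: "0 < a" "0 < b"
    and L1: "\<And>f. f \<in> Lp_space M 1 \<inter> Lp_space M 2 \<Longrightarrow> Lp_norm M \<infinity> (A2 (B1 f)) \<le> ennreal a * Lp_norm M 1 f"
    and L2: "\<And>f. f \<in> Lp_space M 2 \<Longrightarrow> Lp_norm M 2 (A2 (B1 f)) \<le> ennreal b * Lp_norm M 2 f"
begin

text \<open>By adjointness the inner product is the pairing of \<open>A2 (B1 \<phi>)\<close> with
  \<psi>, which turns the operator bound into a bound of a sesquilinear form; \<open>bound_2\<close>
  rests on the same reduction.\<close>

lemma bound_1:
  assumes \<phi>: "finite_simple M \<phi>" and \<psi>: "finite_simple M \<psi>"
  shows "ennreal (cmod (cinner (B1 \<phi>) (B2 \<psi>))) \<le> ennreal a * Lp_norm M 1 \<phi> * Lp_norm M 1 \<psi>"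
proof -
  note [measurable] = Lp_space_measurable[OF A2] finite_simple_measurable[OF \<psi>]
  let ?g = "A2 (B1 \<phi>)"
  have "ennreal (cmod (cinner (B1 \<phi>) (B2 \<psi>))) = ennreal (cmod (pairing M ?g \<psi>))"
    by (simp add: adjoint_pairing[OF adj2 finite_simple_Lp_1_2(2)[OF \<psi>]])
  also have "\<dots> \<le> (\<integral>\<^sup>+y. ennreal (cmod (?g y * cnj (\<psi> y))) \<partial>M)"
    unfolding pairing_def by (rule norm_integral_le_nn_integral)
  also have "\<dots> \<le> (\<integral>\<^sup>+y. Lp_norm M \<infinity> ?g * ennreal (cmod (\<psi> y)) \<partial>M)"
  proof (rule nn_integral_mono_AE)
    show "AE y in M. ennreal (cmod (?g y * cnj (\<psi> y))) \<le> Lp_norm M \<infinity> ?g * ennreal (cmod (\<psi> y))"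
      using esssup_AE[where M = M and f = "\<lambda>y. ennreal (cmod (?g y))"]
    proof eventually_elim
      case (elim y)
      then show ?case
        by (simp add: Lp_norm_def ennreal_Lp_norm_def norm_mult ennreal_mult mult_right_mono)
    qed
  qed
  also have "\<dots> = Lp_norm M \<infinity> ?g * Lp_norm M 1 \<psi>"
    unfolding Lp_norm_1 by (rule nn_integral_cmult) measurable
  also have "\<dots> \<le> (ennreal a * Lp_norm M 1 \<phi>) * Lp_norm M 1 \<psi>"
    using finite_simple_Lp_1_2[OF \<phi>] by (intro mult_right_mono L1) auto
  finally show ?thesis .
qed

lemma bound_2:
  assumes \<phi>: "finite_simple M \<phi>" and \<psi>: "finite_simple M \<psi>"
  shows "ennreal (cmod (cinner (B1 \<phi>) (B2 \<psi>))) \<le> ennreal b * Lp_norm M 2 \<phi> * Lp_norm M 2 \<psi>"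
proof -
  note [measurable] = Lp_space_measurable[OF A2] finite_simple_measurable[OF \<psi>]
  have "ennreal (cmod (cinner (B1 \<phi>) (B2 \<psi>))) = ennreal (cmod (pairing M (A2 (B1 \<phi>)) \<psi>))"
    by (simp add: adjoint_pairing[OF adj2 finite_simple_Lp_1_2(2)[OF \<psi>]])
  also have "\<dots> \<le> Lp_norm M 2 (A2 (B1 \<phi>)) * Lp_norm M 2 \<psi>"
    unfolding pairing_def by (rule norm_integral_le_Lp_norm_2) measurable
  also have "\<dots> \<le> (ennreal b * Lp_norm M 2 \<phi>) * Lp_norm M 2 \<psi>"
    using finite_simple_Lp_1_2[OF \<phi>] by (intro mult_right_mono L2) auto
  finally show ?thesis .
qed

text \<open>At \<theta> = 0 and \<theta> = 1, that is q = 1 and q = 2, the form bounds apply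
  directly. In between, the level sets of \<phi> and \<psi> reduce the form to a matrix, to which
  complex interpolation applies.\<close>

lemma interpolated_bound:
  assumes \<phi>: "\<phi> \<in> dual_ball M q" and \<psi>: "\<psi> \<in> dual_ball M q"
    and \<theta>: "0 \<le> \<theta>" "\<theta> \<le> 1" and q: "q * (1 - \<theta> / 2) = 1"
  shows "cmod (cinner (B1 \<phi>) (B2 \<psi>)) \<le> a powr (1 - \<theta>) * b powr \<theta>"
proof -
  have fs: "finite_simple M \<phi>" "finite_simple M \<psi>"
    and n: "(\<integral>\<^sup>+x. ennreal (cmod (\<phi> x) powr q) \<partial>M) \<le> 1" "(\<integral>\<^sup>+x. ennreal (cmod (\<psi> x) powr q) \<partial>M) \<le> 1"
    using \<phi> \<psi> by (auto simp: dual_ball_def)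
  consider "\<theta> = 0" | "\<theta> = 1" | "0 < \<theta>" "\<theta> < 1" using \<theta> by linarith
  then show ?thesis
  proof cases
    case 1
    then have "q = 1" using q by simp
    then have "Lp_norm M 1 \<phi> \<le> 1" "Lp_norm M 1 \<psi> \<le> 1" using n by (simp_all add: Lp_norm_1)
    then have "ennreal a * Lp_norm M 1 \<phi> * Lp_norm M 1 \<psi> \<le> ennreal a * 1 * 1"
      by (intro mult_mono) auto
    with bound_1[OF fs] have "ennreal (cmod (cinner (B1 \<phi>) (B2 \<psi>))) \<le> ennreal a" by simp
    then show ?thesis using 1 ab by simp
  next
    case 2
    then have q2: "q = 2" using q by simp
    have "(Lp_norm M 2 f)\<^sup>2 = (\<integral>\<^sup>+x. ennreal (cmod (f x) powr q) \<partial>M)" for f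
      by (simp add: Lp_norm_2_square q2 ennreal_power)
    then have "(Lp_norm M 2 \<phi>)\<^sup>2 \<le> 1\<^sup>2" "(Lp_norm M 2 \<psi>)\<^sup>2 \<le> 1\<^sup>2" using n by simp_all
    note this[THEN ennreal_power2_le_imp_le]
    then have "ennreal b * Lp_norm M 2 \<phi> * Lp_norm M 2 \<psi> \<le> ennreal b * 1 * 1"
      by (intro mult_mono) auto
    with bound_2[OF fs] have "ennreal (cmod (cinner (B1 \<phi>) (B2 \<psi>))) \<le> ennreal b" by simp
    then show ?thesis using 2 ab by simp
  next
    case 3
    define I where "I = \<phi> ` space M - {0}"
    define S where "S = (\<lambda>v. {y \<in> space M. \<phi> y = v})"
    define J where "J = \<psi> ` space M - {0}"
    define T where "T = (\<lambda>v. {y \<in> space M. \<psi> y = v})"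
    have IS: "finite I" "disjoint_family_on S I" "\<And>v. v \<in> I \<Longrightarrow> S v \<in> fmeasurable M"
      "\<And>y. y \<in> space M \<Longrightarrow> step_fun I S (\<lambda>v. v) y = \<phi> y"
      unfolding I_def S_def by (fact finite_simple_step_fun_eq[OF fs(1)])+
    note IS3 = IS(1-3)
    have JT: "finite J" "disjoint_family_on T J" "\<And>v. v \<in> J \<Longrightarrow> T v \<in> fmeasurable M"
      "\<And>y. y \<in> space M \<Longrightarrow> step_fun J T (\<lambda>v. v) y = \<psi> y"
      unfolding J_def T_def by (fact finite_simple_step_fun_eq[OF fs(2)])+
    note JT3 = JT(1-3)
    define c where "c i j = cinner (B1 (indicator (S i))) (B2 (indicator (T j)))" for i j
    have B1s: "B1 (step_fun I S x) = (\<Sum>i\<in>I. scaleC (x i) (B1 (indicator (S i))))" for x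
      by (rule adjoint_step_fun[OF adj1 A1 IS3])
    have B2s: "B2 (step_fun J T y) = (\<Sum>j\<in>J. scaleC (y j) (B2 (indicator (T j))))" for y
      by (rule adjoint_step_fun[OF adj2 A2 JT3])
    have n1: "Lp_norm M 1 (step_fun I S x) = ennreal (\<Sum>i\<in>I. cmod (x i) * measure M (S i))"
      "Lp_norm M 1 (step_fun J T x) = ennreal (\<Sum>j\<in>J. cmod (x j) * measure M (T j))" for x
      by (rule Lp_norm_1_step_fun[OF IS3] Lp_norm_1_step_fun[OF JT3]; assumption)+
    have n2: "Lp_norm M 2 (step_fun I S x) = ennreal (sqrt (\<Sum>i\<in>I. (cmod (x i))\<^sup>2 * measure M (S i)))"
      "Lp_norm M 2 (step_fun J T x) = ennreal (sqrt (\<Sum>j\<in>J. (cmod (x j))\<^sup>2 * measure M (T j)))" for x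
      by (rule Lp_norm_2_step_fun[OF IS3] Lp_norm_2_step_fun[OF JT3]; assumption)+
    have expand: "cinner (B1 (step_fun I S x)) (B2 (step_fun J T y)) = (\<Sum>i\<in>I. \<Sum>j\<in>J. x i * cnj (y j) * c i j)" for x y
      unfolding B1s B2s
      unfolding cinner_sum_left cinner_sum_right cinner_scaleC_left cinner_scaleC_right c_def sum_distrib_left
      by (subst sum.swap) (simp add: mult_ac)
    have fsI: "finite_simple M (step_fun I S x)" for x by (rule finite_simple_step_fun[OF IS3])
    have fsJ: "finite_simple M (step_fun J T x)" for x by (rule finite_simple_step_fun[OF JT3])
    have snn: "0 \<le> (\<Sum>i\<in>K. g i * measure M (R i))" if "\<And>i. 0 \<le> g i" for K g and R :: "complex \<Rightarrow> 'a set"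
      using that by (intro sum_nonneg mult_nonneg_nonneg) auto
    \<comment> \<open>The bounds are proved for arbitrary coefficients, since the analytic
      deformation in \<open>riesz_thorin_matrix\<close> moves them away from the values of \<phi>
      and \<psi>.\<close>
    have b1: "cmod (\<Sum>i\<in>I. \<Sum>j\<in>J. x i * cnj (y j) * c i j)
        \<le> a * (\<Sum>i\<in>I. cmod (x i) * measure M (S i)) * (\<Sum>j\<in>J. cmod (y j) * measure M (T j))" for x y
    proof -
      have "ennreal (cmod (\<Sum>i\<in>I. \<Sum>j\<in>J. x i * cnj (y j) * c i j))
        \<le> ennreal (a * (\<Sum>i\<in>I. cmod (x i) * measure M (S i)) * (\<Sum>j\<in>J. cmod (y j) * measure M (T j)))"
        using bound_1[OF fsI[of x] fsJ[of y]] ab snn[of "\<lambda>i. cmod (x i)"] snn[of "\<lambda>i. cmod (y i)"]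
        unfolding expand n1
        by (simp add: ennreal_mult)
      then show ?thesis using ab snn[of "\<lambda>i. cmod (x i)"] snn[of "\<lambda>i. cmod (y i)"] by simp
    qed
    have b2: "cmod (\<Sum>i\<in>I. \<Sum>j\<in>J. x i * cnj (y j) * c i j)
        \<le> b * sqrt (\<Sum>i\<in>I. (cmod (x i))\<^sup>2 * measure M (S i)) * sqrt (\<Sum>j\<in>J. (cmod (y j))\<^sup>2 * measure M (T j))" for x y
    proof -
      have "ennreal (cmod (\<Sum>i\<in>I. \<Sum>j\<in>J. x i * cnj (y j) * c i j))
        \<le> ennreal (b * sqrt (\<Sum>i\<in>I. (cmod (x i))\<^sup>2 * measure M (S i)) * sqrt (\<Sum>j\<in>J. (cmod (y j))\<^sup>2 * measure M (T j)))"
        using bound_2[OF fsI[of x] fsJ[of y]] ab snn[of "\<lambda>i. (cmod (x i))\<^sup>2"] snn[of "\<lambda>i. (cmod (y i))\<^sup>2"]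
        unfolding expand n2
        by (simp add: ennreal_mult)
      then show ?thesis using ab snn[of "\<lambda>i. (cmod (x i))\<^sup>2"] snn[of "\<lambda>i. (cmod (y i))\<^sup>2"] by simp
    qed
    have eq: "B1 \<phi> = B1 (step_fun I S (\<lambda>v. v))" "B2 \<psi> = B2 (step_fun J T (\<lambda>v. v))"
      using IS(4) JT(4) fs fsI fsJ
      by (auto intro!: adjoint_cong[OF adj1] adjoint_cong[OF adj2] finite_simple_Lp_1_2)
    have "ennreal (\<Sum>i\<in>I. cmod i powr q * measure M (S i)) = (\<integral>\<^sup>+y. ennreal (cmod (step_fun I S (\<lambda>v. v) y) powr q) \<partial>M)"
      by (rule nn_integral_step_fun[OF IS3, where G = "\<lambda>z. cmod z powr q", symmetric]) auto
    also have "\<dots> = (\<integral>\<^sup>+y. ennreal (cmod (\<phi> y) powr q) \<partial>M)"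
      using IS(4) by (intro nn_integral_cong) simp
    also have "\<dots> \<le> ennreal 1" using n by simp
    finally have X: "(\<Sum>i\<in>I. cmod i powr q * measure M (S i)) \<le> 1" by simp
    have "ennreal (\<Sum>i\<in>J. cmod i powr q * measure M (T i)) = (\<integral>\<^sup>+y. ennreal (cmod (step_fun J T (\<lambda>v. v) y) powr q) \<partial>M)"
      by (rule nn_integral_step_fun[OF JT3, where G = "\<lambda>z. cmod z powr q", symmetric]) auto
    also have "\<dots> = (\<integral>\<^sup>+y. ennreal (cmod (\<psi> y) powr q) \<partial>M)"
      using JT(4) by (intro nn_integral_cong) simp
    also have "\<dots> \<le> ennreal 1" using n by simp
    finally have Y: "(\<Sum>j\<in>J. cmod j powr q * measure M (T j)) \<le> 1" by simp
    have "cmod (cinner (B1 \<phi>) (B2 \<psi>)) \<le> a powr (1 - \<theta>) * b powr \<theta> *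
      ((\<Sum>i\<in>I. cmod i powr q * measure M (S i)) powr (1 - \<theta> / 2) *
       (\<Sum>j\<in>J. cmod j powr q * measure M (T j)) powr (1 - \<theta> / 2))"
      unfolding eq expand using ab
      by (intro riesz_thorin_matrix[OF _ _ b1 b2 _ _ _ _ _ _ 3 q] IS(1) JT(1)) (auto simp: I_def J_def)
    also have "\<dots> \<le> a powr (1 - \<theta>) * b powr \<theta> * (1 * 1)"
      using X Y \<theta> snn[of "\<lambda>v. cmod v powr q"] by (intro mult_left_mono mult_mono powr_le1 snn) auto
    finally show ?thesis by simp
  qed
qed

end

section \<open>Families with decay\<close>

lemma scaleC_norm_cinner:
  "cmod (cinner (scaleC c x) (scaleC d y)) = cmod c * cmod d * cmod (cinner x (y::'h::complex_hilbert_space))"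
  by (simp add: cinner_scaleC_left cinner_scaleC_right norm_mult mult_ac)

text \<open>What remains of the two estimates after interpolation is one decay bound on the dual
  ball. In the application K carries the factor \<open>h powr (- \<mu>)\<close> and \<kappa> is
  2/r.\<close>

locale decaying_family =
  fixes M :: "'a measure" and W :: "real \<Rightarrow> 'h::complex_hilbert_space \<Rightarrow> 'a \<Rightarrow> complex"
    and Wstar :: "real \<Rightarrow> ('a \<Rightarrow> complex) \<Rightarrow> 'h" and p :: ennreal and q h K \<kappa> :: real
  assumes W: "\<And>t f. W t f \<in> Lp_space M 2"
    and adj: "\<And>t. is_adjoint_L2 M (W t) (Wstar t)"
    and meas: "\<And>f. strongly_measurable_L2 M (\<lambda>t. W t f)"
    and p: "1 < p" and q: "1 \<le> q" and pq: "1 / q + enn2real (1 / p) = 1"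
    and h: "0 < h" and K: "0 \<le> K" and \<kappa>: "0 \<le> \<kappa>"
    and decay: "\<And>t s \<phi> \<psi>. \<phi> \<in> dual_ball M q \<Longrightarrow> \<psi> \<in> dual_ball M q \<Longrightarrow>
      cmod (cinner (Wstar s \<phi>) (Wstar t \<psi>)) \<le> K * (h + \<bar>t - s\<bar>) powr (- \<kappa>)"
begin

lemma pairing_W: "\<psi> \<in> dual_ball M q \<Longrightarrow> pairing M (W t f) \<psi> = cinner f (Wstar t \<psi>)"
  by (rule adjoint_pairing[OF adj dual_ball_L2])

text \<open>The decay bound with s = t, finite because h > 0 and uniform in t. For \<kappa> = 0 the
  factor in h equals 1 and the bound is already the one wanted for r = \<infinity>.\<close>

lemma norm_Wstar_le:
  assumes "\<psi> \<in> dual_ball M q"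
  shows "norm (Wstar t \<psi>) \<le> sqrt (K * h powr (- \<kappa>))"
proof -
  have "(norm (Wstar t \<psi>))\<^sup>2 \<le> K * h powr (- \<kappa>)"
    using decay[OF assms assms, of t t] by (simp add: cinner_self norm_power)
  then show ?thesis by (rule real_le_rsqrt)
qed

lemma cmod_pairing_le:
  assumes "\<psi> \<in> dual_ball M q"
  shows "cmod (pairing M (W t f) \<psi>) \<le> sqrt (K * h powr (- \<kappa>)) * norm f"
  using norm_cinner_le[of f "Wstar t \<psi>"] mult_left_mono[OF norm_Wstar_le[OF assms, of t], of "norm f"]
  by (simp add: pairing_W[OF assms] mult.commute)

lemma Lp_norm_W: "Lp_norm M p (W t f) = (SUP \<psi>\<in>dual_ball M q. ennreal (cmod (pairing M (W t f) \<psi>)))"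
  unfolding pairing_def by (rule Lp_norm_eq_SUP[OF W p q pq])

lemma measurable_pairing_W:
  "\<psi> \<in> dual_ball M q \<Longrightarrow> (\<lambda>t. pairing M (W t f) \<psi>) \<in> borel_measurable lebesgue"
  by (rule measurable_pairing[OF meas W dual_ball_L2])

lemma norming_sequence:
  obtains \<psi> :: "nat \<Rightarrow> 'a \<Rightarrow> complex" where "\<And>k. \<psi> k \<in> dual_ball M q"
    "AE t in lebesgue. Lp_norm M p (W t f) = (SUP k. ennreal (cmod (pairing M (W t f) (\<psi> k))))"
  using countable_norming[OF meas W, of q f] unfolding Lp_norm_W[symmetric] by blast

lemma measurable_Lp_norm_W: "(\<lambda>t. Lp_norm M p (W t f)) \<in> borel_measurable lebesgue"
proof -
  obtain \<psi> where \<psi>: "\<And>k::nat. \<psi> k \<in> dual_ball M q"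
    "AE t in lebesgue. Lp_norm M p (W t f) = (SUP k. ennreal (cmod (pairing M (W t f) (\<psi> k))))"
    using norming_sequence[of f] by blast
  note [measurable] = measurable_pairing_W[OF \<psi>(1)]
  show ?thesis by (rule measurable_lebesgue_AE_cong[OF _ \<psi>(2)]) auto
qed

lemma strichartz_infinity:
  assumes "\<kappa> = 0"
  shows "ennreal_Lp_norm lebesgue \<infinity> (\<lambda>t. Lp_norm M p (W t f)) \<le> ennreal (sqrt K * norm f)"
proof -
  have "Lp_norm M p (W t f) \<le> ennreal (sqrt K * norm f)" for t
    unfolding Lp_norm_W using cmod_pairing_le[of _ t f] assms h by (intro SUP_least ennreal_leI) simp
  then show ?thesis by (simp add: ennreal_Lp_norm_def esssup_I measurable_Lp_norm_W)
qed

text \<open>The test function in time and space draws its space part from a countable list by a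
  measurable index k, which keeps the integrand measurable. The integrand is the inner product of f
  with b(t), and the double integral of the inner products of b with itself is dominated by a
  Hardy-Littlewood-Sobolev integral of w.\<close>

lemma dual_estimate:
  fixes w :: "real \<Rightarrow> real" and \<omega> :: "real \<Rightarrow> complex" and k :: "real \<Rightarrow> nat"
  assumes r: "2 < r" and \<kappa>r: "\<kappa> = 2 / r" and r': "1 < r'" and rr': "1 / r' + 1 / r = 1"
    and w: "finite_simple lebesgue w" and w0: "\<And>t. 0 \<le> w t"
    and w1: "(\<integral>\<^sup>+t. ennreal (w t powr r') \<partial>lebesgue) \<le> 1"
    and \<omega>[measurable]: "\<omega> \<in> borel_measurable lebesgue" and \<omega>w: "\<And>t. cmod (\<omega> t) \<le> w t"
    and k: "k \<in> measurable lebesgue (count_space UNIV)"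
    and \<psi>: "\<And>k. \<psi> k \<in> dual_ball M q"
  shows "integrable lebesgue (\<lambda>t. \<omega> t * pairing M (W t f) (\<psi> (k t)))"
    and "cmod (\<integral>t. \<omega> t * pairing M (W t f) (\<psi> (k t)) \<partial>lebesgue) \<le> sqrt (2 * K * hls_const r r') * norm f"
proof -
  have [measurable]: "w \<in> borel_measurable lebesgue" by (rule finite_simple_measurable[OF w])
  have wint: "integrable lebesgue w"
  proof (rule integrableI_bounded)
    show "(\<integral>\<^sup>+t. ennreal (norm (w t)) \<partial>lebesgue) < \<infinity>"
      using finite_simple_nn_integral_finite[OF w, of norm] by simp
  qed simp
  have pm: "(\<lambda>t. pairing M (W t g) (\<psi> (k t))) \<in> borel_measurable lebesgue" for g
    by (rule measurable_compose_countable[OF measurable_pairing_W[OF \<psi>] k])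
  \<comment> \<open>A bound depending on h, used for integrability and for the continuity of the
    functional; it does not reach the final constant.\<close>
  define L where "L = sqrt (K * h powr (- \<kappa>))"
  have bd: "cmod (\<omega> t * pairing M (W t g) (\<psi> (k t))) \<le> w t * (L * norm g)" for t g
    unfolding norm_mult using \<omega>w w0 cmod_pairing_le[OF \<psi>] by (intro mult_mono) (auto simp: L_def)
  have int: "integrable lebesgue (\<lambda>t. \<omega> t * pairing M (W t g) (\<psi> (k t)))" for g
  proof (rule Bochner_Integration.integrable_bound)
    show "integrable lebesgue (\<lambda>t. w t * (L * norm g))" using wint by simp
    show "(\<lambda>t. \<omega> t * pairing M (W t g) (\<psi> (k t))) \<in> borel_measurable lebesgue"
      using pm by measurable
    show "AE t in lebesgue. norm (\<omega> t * pairing M (W t g) (\<psi> (k t))) \<le> norm (w t * (L * norm g))"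
      by (intro AE_I2 order_trans[OF bd]) (simp only: real_norm_def abs_ge_self)
  qed
  then show "integrable lebesgue (\<lambda>t. \<omega> t * pairing M (W t f) (\<psi> (k t)))" .
  define b where "b t = scaleC (cnj (\<omega> t)) (Wstar t (\<psi> (k t)))" for t
  have cb: "cinner g (b t) = \<omega> t * pairing M (W t g) (\<psi> (k t))" for g t
    by (simp add: b_def cinner_scaleC_right pairing_W[OF \<psi>])
  have "cmod (\<integral>t. cinner f (b t) \<partial>lebesgue) \<le> sqrt (2 * K * hls_const r r') * norm f"
  proof (rule weak_integral_bound)
    show "integrable lebesgue (\<lambda>t. cinner g (b t))" for g unfolding cb by (rule int)
    show "cmod (\<integral>t. cinner g (b t) \<partial>lebesgue) \<le> ((\<integral>t. w t \<partial>lebesgue) * L) * norm g" for g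
    proof -
      have "cmod (\<integral>t. cinner g (b t) \<partial>lebesgue) \<le> (\<integral>t. w t * (L * norm g) \<partial>lebesgue)"
        unfolding cb using wint
        by (intro order_trans[OF integral_norm_bound] integral_mono integrable_norm int bd) simp
      then show ?thesis by (simp add: mult.assoc)
    qed
    have hc: "0 \<le> hls_const r r'" using r r' by (simp add: hls_const_def)
    then show "0 \<le> 2 * K * hls_const r r'" using K by simp
    have "(\<integral>\<^sup>+t. (\<integral>\<^sup>+s. ennreal (cmod (cinner (b t) (b s))) \<partial>lebesgue) \<partial>lebesgue)
      \<le> (\<integral>\<^sup>+t. (\<integral>\<^sup>+s. ennreal K * ennreal (w t * w s * \<bar>s - t\<bar> powr (- 2 / r)) \<partial>lebesgue) \<partial>lebesgue)"
    proof (rule nn_integral_mono, rule nn_integral_mono_AE)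
      fix t :: real
      \<comment> \<open>At s = t the comparison of kernels would break down, as
        \<open>0 powr x = 0\<close>; a single point is negligible.\<close>
      have "AE s in lebesgue. s \<noteq> t" using AE_completion[OF AE_lborel_singleton[of t]] by simp
      then show "AE s in lebesgue. ennreal (cmod (cinner (b t) (b s)))
        \<le> ennreal K * ennreal (w t * w s * \<bar>s - t\<bar> powr (- 2 / r))"
      proof eventually_elim
        case (elim s)
        have "cmod (cinner (b t) (b s)) \<le> w t * w s * (K * (h + \<bar>s - t\<bar>) powr (- \<kappa>))"
          unfolding b_def scaleC_norm_cinner using w0 \<omega>w
          by (intro mult_mono decay \<psi>) auto
        also have "\<dots> \<le> w t * w s * (K * \<bar>s - t\<bar> powr (- \<kappa>))"
          using elim h \<kappa> K w0 by (intro mult_left_mono powr_mono2') auto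
        also have "\<dots> = K * (w t * w s * \<bar>s - t\<bar> powr (- 2 / r))" by (simp add: \<kappa>r mult_ac)
        finally have "ennreal (cmod (cinner (b t) (b s))) \<le> ennreal (K * (w t * w s * \<bar>s - t\<bar> powr (- 2 / r)))"
          by (rule ennreal_leI)
        then show ?case using K w0 by (simp add: ennreal_mult)
      qed
    qed
    also have "\<dots> \<le> ennreal K * ennreal (2 * hls_const r r')"
      by (rule hls_lebesgue[OF _ w0 r r' rr' w1]) measurable
    also have "\<dots> = ennreal (2 * K * hls_const r r')" using K hc by (simp add: ennreal_mult[symmetric] mult_ac)
    finally show "(\<integral>\<^sup>+t. (\<integral>\<^sup>+s. ennreal (cmod (cinner (b t) (b s))) \<partial>lebesgue) \<partial>lebesgue) \<le> \<dots>" .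
  qed
  then show "cmod (\<integral>t. \<omega> t * pairing M (W t f) (\<psi> (k t)) \<partial>lebesgue) \<le> sqrt (2 * K * hls_const r r') * norm f"
    unfolding cb .
qed

text \<open>Duality in time gives a simple weight \<sigma>; monotone convergence replaces the
  supremum over the norming sequence by a maximum over finitely many members, and choosing the best
  of them at each time gives a test function for \<open>dual_estimate\<close>.\<close>

lemma strichartz_finite:
  assumes r: "2 < r" and \<kappa>r: "\<kappa> = 2 / r" and r': "1 < r'" and rr': "1 / r' + 1 / r = 1"
  shows "ennreal_Lp_norm lebesgue (ennreal r) (\<lambda>t. Lp_norm M p (W t f))
    \<le> ennreal (sqrt (2 * K * hls_const r r') * norm f)"
proof (rule dense_le)
  fix a assume a: "a < ennreal_Lp_norm lebesgue (ennreal r) (\<lambda>t. Lp_norm M p (W t f))"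
  obtain \<psi> where \<psi>: "\<And>k::nat. \<psi> k \<in> dual_ball M q"
    "AE t in lebesgue. Lp_norm M p (W t f) = (SUP k. ennreal (cmod (pairing M (W t f) (\<psi> k))))"
    using norming_sequence[of f] by blast
  define c where "c j t = cmod (pairing M (W t f) (\<psi> j))" for j t
  have [measurable]: "c j \<in> borel_measurable lebesgue" for j
    unfolding c_def using measurable_pairing_W[OF \<psi>(1)] by measurable
  have one_r: "1 < ennreal r" using r by (simp add: ennreal_less_iff[of 1, simplified])
  have ir: "1 / r' + enn2real (1 / ennreal r) = 1"
    using r rr' by (simp add: divide_ennreal_def inverse_ennreal inverse_eq_divide)
  have "\<exists>\<sigma>::real \<Rightarrow> real. finite_simple lebesgue \<sigma> \<and> (\<forall>x. 0 \<le> \<sigma> x)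
    \<and> (\<integral>\<^sup>+x. ennreal (\<sigma> x powr r') \<partial>lebesgue) \<le> 1 \<and> a < (\<integral>\<^sup>+x. ennreal (\<sigma> x) * Lp_norm M p (W x f) \<partial>lebesgue)"
  proof (rule ennreal_Lp_norm_dual_witness[OF _ _ _ _ one_r _ ir a])
    show "emeasure lebesgue {- real n..real n} \<noteq> \<infinity>" for n by simp
    show "x \<in> (\<Union>n. {- real n..real n})" for x :: real
    proof -
      obtain n where "\<bar>x\<bar> \<le> real n" using real_arch_simple by blast
      then have "x \<in> {- real n..real n}" by auto
      then show ?thesis by blast
    qed
  qed (use r' measurable_Lp_norm_W in auto)
  then obtain \<sigma> :: "real \<Rightarrow> real" where \<sigma>: "finite_simple lebesgue \<sigma>" "\<And>x. 0 \<le> \<sigma> x"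
    "(\<integral>\<^sup>+x. ennreal (\<sigma> x powr r') \<partial>lebesgue) \<le> 1"
    "a < (\<integral>\<^sup>+x. ennreal (\<sigma> x) * Lp_norm M p (W x f) \<partial>lebesgue)" by blast
  have [measurable]: "\<sigma> \<in> borel_measurable lebesgue" by (rule finite_simple_measurable[OF \<sigma>(1)])
  define m where "m n t = Max ((\<lambda>j. c j t) ` {..n})" for n t
  \<comment> \<open>A finite maximum is attained; taking the least index that attains it makes the
    choice measurable in t.\<close>
  define kk where "kk n t = (LEAST j. c j t = m n t)" for n t
  have mc: "c (kk n t) t = m n t" for n t
  proof -
    have "m n t \<in> (\<lambda>j. c j t) ` {..n}" unfolding m_def by (intro Max_in) auto
    then obtain j where "c j t = m n t" by (metis imageE)
    then show ?thesis unfolding kk_def by (rule LeastI)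
  qed
  have [measurable]: "m n \<in> borel_measurable lebesgue" for n
    unfolding m_def by (intro borel_measurable_Max) auto
  have km: "kk n \<in> measurable lebesgue (count_space UNIV)" for n
    unfolding kk_def by (rule measurable_Least) measurable
  have m0: "0 \<le> m n t" for n t unfolding mc[symmetric] by (simp add: c_def)
  have mmono: "incseq (\<lambda>n. m n t)" for t
    unfolding m_def by (intro incseq_SucI Max_mono) auto
  have SUPm: "(SUP n. ennreal (m n t)) = (SUP k. ennreal (c k t))" for t
  proof (intro antisym SUP_least)
    show "ennreal (m n t) \<le> (SUP k. ennreal (c k t))" for n unfolding mc[symmetric] by (rule SUP_upper) simp
    show "ennreal (c k t) \<le> (SUP n. ennreal (m n t))" for k
      by (rule SUP_upper2[of k]) (auto simp: m_def intro!: ennreal_leI Max_ge)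
  qed
  have "(\<integral>\<^sup>+x. ennreal (\<sigma> x) * Lp_norm M p (W x f) \<partial>lebesgue)
    = (\<integral>\<^sup>+x. (SUP n. ennreal (\<sigma> x) * ennreal (m n x)) \<partial>lebesgue)"
    by (rule nn_integral_cong_AE)
      (use \<psi>(2) in \<open>eventually_elim, simp add: SUP_mult_left_ennreal[symmetric] SUPm c_def\<close>)
  also have "\<dots> = (SUP n. \<integral>\<^sup>+x. ennreal (\<sigma> x) * ennreal (m n x) \<partial>lebesgue)"
  proof (rule nn_integral_monotone_convergence_SUP)
    show "incseq (\<lambda>n x. ennreal (\<sigma> x) * ennreal (m n x))"
      using mmono by (auto simp: incseq_def le_fun_def intro!: mult_left_mono ennreal_leI)
  qed measurable
  finally obtain n where n: "a < (\<integral>\<^sup>+x. ennreal (\<sigma> x) * ennreal (m n x) \<partial>lebesgue)"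
    using \<sigma>(4) by (auto simp: less_SUP_iff)
  \<comment> \<open>The phase makes the integrand the nonnegative real function
    \<open>\<sigma> t * m n t\<close>.\<close>
  define \<omega> where "\<omega> t = of_real (\<sigma> t) * cnj (sgn (pairing M (W t f) (\<psi> (kk n t))))" for t
  have pm: "(\<lambda>t. pairing M (W t f) (\<psi> (kk n t))) \<in> borel_measurable lebesgue"
    by (rule measurable_compose_countable[OF measurable_pairing_W[OF \<psi>(1)] km])
  have \<omega>m: "\<omega> \<in> borel_measurable lebesgue" unfolding \<omega>_def using pm by measurable
  have \<omega>\<sigma>: "cmod (\<omega> t) \<le> \<sigma> t" for t using \<sigma>(2)[of t] by (simp add: \<omega>_def norm_mult norm_sgn)
  have prod: "\<omega> t * pairing M (W t f) (\<psi> (kk n t)) = complex_of_real (\<sigma> t * m n t)" for t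
  proof -
    have "cnj (sgn z) * z = complex_of_real (cmod z)" for z
      by (cases "z = 0") (auto simp: sgn_eq complex_norm_square[symmetric] power2_eq_square divide_simps mult.commute)
    then show ?thesis unfolding mc[symmetric] c_def by (simp add: \<omega>_def mult.assoc)
  qed
  note est = dual_estimate[where f = f and k = "kk n" and \<psi> = \<psi>,
      OF r \<kappa>r r' rr' \<sigma>(1-3) \<omega>m \<omega>\<sigma> km \<psi>(1), unfolded prod]
  have int: "integrable lebesgue (\<lambda>t. \<sigma> t * m n t)" using est(1) by (simp only: complex_of_real_integrable_eq)
  have "(\<integral>\<^sup>+x. ennreal (\<sigma> x) * ennreal (m n x) \<partial>lebesgue) = (\<integral>\<^sup>+x. ennreal (\<sigma> x * m n x) \<partial>lebesgue)"
    using \<sigma>(2) m0 by (simp add: ennreal_mult)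
  also have "\<dots> = ennreal (\<integral>x. \<sigma> x * m n x \<partial>lebesgue)"
    using \<sigma>(2) m0 by (intro nn_integral_eq_integral int) auto
  also have "\<dots> \<le> ennreal (cmod (\<integral>t. complex_of_real (\<sigma> t * m n t) \<partial>lebesgue))"
    unfolding integral_complex_of_real by (intro ennreal_leI) simp
  also have "\<dots> \<le> ennreal (sqrt (2 * K * hls_const r r') * norm f)"
    using est(2) by (intro ennreal_leI)
  finally show "a \<le> ennreal (sqrt (2 * K * hls_const r r') * norm f)" using n by simp
qed

end

section \<open>Exponents and conclusion\<close>

lemma enn2real_one_divide_le_half:
  fixes x :: ennreal
  assumes "2 \<le> x"
  shows "0 \<le> enn2real (1 / x)" "enn2real (1 / x) \<le> 1 / 2"
proof -
  show "0 \<le> enn2real (1 / x)" by simp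
  show "enn2real (1 / x) \<le> 1 / 2"
  proof (cases x)
    case (real y)
    then have "2 \<le> y" using assms by (metis ennreal_le_iff ennreal_numeral)
    then show ?thesis using real by (simp add: divide_ennreal_def inverse_ennreal inverse_eq_divide)
  qed (simp add: divide_ennreal_def)
qed

theorem proposition3p1:
  fixes \<mu>_inf \<sigma>_inf \<mu>_2 \<sigma>_2 :: real
    and C_inf C_2 :: real
    and r p :: ennreal
  assumes "\<sigma>_inf \<noteq> \<sigma>_2"
    and "2 < r" and "2 \<le> p"
    and "enn2real (1 / r) + enn2real (1 / p) * (\<sigma>_inf - \<sigma>_2) = \<sigma>_inf / 2"
  shows "\<exists>C\<ge>0. \<forall>(h::real) (M :: 'x measure)
      (W :: real \<Rightarrow> 'h::complex_hilbert_space \<Rightarrow> 'x \<Rightarrow> complex)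
      (Wstar :: real \<Rightarrow> ('x \<Rightarrow> complex) \<Rightarrow> 'h).
    h > 0 \<longrightarrow>
    (\<forall>t. linear_into_L2 M (W t)) \<longrightarrow>
    (\<forall>t. is_adjoint_L2 M (W t) (Wstar t)) \<longrightarrow>
    (\<forall>f. strongly_measurable_L2 M (\<lambda>t. W t f)) \<longrightarrow>
    (\<forall>t s. \<forall>f \<in> Lp_space M 1 \<inter> Lp_space M 2.
       Lp_norm M \<infinity> (W t (Wstar s f))
         \<le> ennreal (C_inf * h powr (- \<mu>_inf) * (h + \<bar>t - s\<bar>) powr (- \<sigma>_inf)) * Lp_norm M 1 f) \<longrightarrow>
    (\<forall>t s. \<forall>f \<in> Lp_space M 2.
       Lp_norm M 2 (W t (Wstar s f))
         \<le> ennreal (C_2 * h powr (- \<mu>_2) * (h + \<bar>t - s\<bar>) powr (- \<sigma>_2)) * Lp_norm M 2 f) \<longrightarrow>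
    (\<forall>f. ennreal_Lp_norm lebesgue r (\<lambda>t. Lp_norm M p (W t f))
         \<le> ennreal (C * h powr (- (enn2real (1 / r) * ((\<mu>_inf - \<mu>_2) / (\<sigma>_inf - \<sigma>_2))
                                   + (\<sigma>_inf * \<mu>_2 - \<sigma>_2 * \<mu>_inf) / (2 * (\<sigma>_inf - \<sigma>_2))))
                    * norm f))"
proof -
  \<comment> \<open>\<theta> = 2/p solves 1/q = 1 - \<theta>/2 with q dual to p; \<kappa> = 2/r is
    the decay exponent and \<mu> the exponent of 1/h in the interpolated bound.\<close>
  define \<theta> where "\<theta> = 2 * enn2real (1 / p)"
  define \<kappa> where "\<kappa> = 2 * enn2real (1 / r)"
  define q where "q = 1 / (1 - \<theta> / 2)"
  define \<mu> where "\<mu> = (1 - \<theta>) * \<mu>_inf + \<theta> * \<mu>_2"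
  \<comment> \<open>\<open>TT_star_bounds\<close> asks for positive constants, so
    \<open>C_inf\<close> and \<open>C_2\<close> are enlarged to at least 1.\<close>
  define a b where "a = max C_inf 1" and "b = max C_2 1"
  define K where "K = a powr (1 - \<theta>) * b powr \<theta>"
  \<comment> \<open>\<open>1 / (1 - 1 / enn2real r)\<close> is the exponent dual to r. The constant
    is built from K before the factor in h is attached, hence independent of h.\<close>
  define C where "C = (if r = \<infinity> then sqrt K
    else sqrt (2 * K * hls_const (enn2real r) (1 / (1 - 1 / enn2real r))))"
  have \<theta>: "0 \<le> \<theta>" "\<theta> \<le> 1" using enn2real_one_divide_le_half[OF assms(3)] by (simp_all add: \<theta>_def)
  have \<kappa>0: "0 \<le> \<kappa>" by (simp add: \<kappa>_def)
  have \<kappa>: "(1 - \<theta>) * \<sigma>_inf + \<theta> * \<sigma>_2 = \<kappa>"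
    using assms(4) by (simp add: \<theta>_def \<kappa>_def algebra_simps)
  \<comment> \<open>With D = \<sigma>_inf - \<sigma>_2, admissibility reads 2/r = \<sigma>_inf -
    \<theta> D; after this substitution the exponent of the statement collapses to \<mu>/2.\<close>
  have ex: "\<mu> / 2 = enn2real (1 / r) * ((\<mu>_inf - \<mu>_2) / (\<sigma>_inf - \<sigma>_2))
      + (\<sigma>_inf * \<mu>_2 - \<sigma>_2 * \<mu>_inf) / (2 * (\<sigma>_inf - \<sigma>_2))"
  proof -
    define x D where "x = enn2real (1 / r)" and "D = \<sigma>_inf - \<sigma>_2"
    have D: "D \<noteq> 0" using assms(1) by (simp add: D_def)
    have x: "2 * x = \<sigma>_inf - \<theta> * D" using \<kappa> by (simp add: \<kappa>_def x_def D_def algebra_simps)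
    have "2 * x * (\<mu>_inf - \<mu>_2) + (\<sigma>_inf * \<mu>_2 - \<sigma>_2 * \<mu>_inf) = D * \<mu>"
      unfolding x D_def \<mu>_def by (simp add: algebra_simps)
    then have "\<mu> / 2 = (2 * x * (\<mu>_inf - \<mu>_2) + (\<sigma>_inf * \<mu>_2 - \<sigma>_2 * \<mu>_inf)) / (2 * D)"
      using D by simp
    also have "\<dots> = x * ((\<mu>_inf - \<mu>_2) / D) + (\<sigma>_inf * \<mu>_2 - \<sigma>_2 * \<mu>_inf) / (2 * D)"
      by (simp add: add_divide_distrib)
    finally show ?thesis by (simp only: x_def D_def)
  qed
  have ab: "1 \<le> a" "1 \<le> b" "C_inf \<le> a" "C_2 \<le> b" by (auto simp: a_def b_def)
  then have K: "0 \<le> K" by (simp add: K_def)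
  have q: "1 \<le> q" "q * (1 - \<theta> / 2) = 1" "1 / q + enn2real (1 / p) = 1"
    using \<theta> by (auto simp: q_def \<theta>_def field_simps)
  have p: "1 < p" using assms(3) by (rule less_le_trans[rotated]) simp
  have C0: "0 \<le> C"
  proof (cases "r = \<infinity>")
    case False
    then have "2 < enn2real r" using assms(2)
      by (cases r) (auto simp: ennreal_less_iff[of 2, simplified])
    then show ?thesis using K by (simp add: C_def hls_const_def)
  qed (use K in \<open>simp add: C_def\<close>)
  show ?thesis
  proof (intro exI[of _ C] conjI C0 allI impI)
    fix h :: real and M :: "'x measure" and W :: "real \<Rightarrow> 'h \<Rightarrow> 'x \<Rightarrow> complex"
      and Wstar :: "real \<Rightarrow> ('x \<Rightarrow> complex) \<Rightarrow> 'h" and f :: 'h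
    assume h: "0 < h" and lin: "\<forall>t. linear_into_L2 M (W t)"
      and adj: "\<forall>t. is_adjoint_L2 M (W t) (Wstar t)"
      and meas: "\<forall>f. strongly_measurable_L2 M (\<lambda>t. W t f)"
      and i: "\<forall>t s. \<forall>f \<in> Lp_space M 1 \<inter> Lp_space M 2.
        Lp_norm M \<infinity> (W t (Wstar s f))
         \<le> ennreal (C_inf * h powr (- \<mu>_inf) * (h + \<bar>t - s\<bar>) powr (- \<sigma>_inf)) * Lp_norm M 1 f"
      and ii: "\<forall>t s. \<forall>f \<in> Lp_space M 2.
        Lp_norm M 2 (W t (Wstar s f))
         \<le> ennreal (C_2 * h powr (- \<mu>_2) * (h + \<bar>t - s\<bar>) powr (- \<sigma>_2)) * Lp_norm M 2 f"
    have W: "W t f \<in> Lp_space M 2" for t f using lin by (simp add: linear_into_L2_def)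
    define K' where "K' = K * h powr (- \<mu>)"
    have K': "0 \<le> K'" using K by (simp add: K'_def)
    interpret decaying_family M W Wstar p q h K' \<kappa>
    proof
      fix t s \<phi> \<psi> assume ball: "\<phi> \<in> dual_ball M q" "\<psi> \<in> dual_ball M q"
      \<comment> \<open>At fixed times both estimates are plain operator bounds; d is positive
        because h is, so its real powers split under interpolation.\<close>
      define d where "d = h + \<bar>t - s\<bar>"
      have d: "0 < d" using h by (simp add: d_def)
      define a' b' where "a' = a * h powr (- \<mu>_inf) * d powr (- \<sigma>_inf)"
        and "b' = b * h powr (- \<mu>_2) * d powr (- \<sigma>_2)"
      have ab': "0 < a'" "0 < b'" using ab h d by (auto simp: a'_def b'_def)
      interpret TT_star_bounds M "W s" "W t" "Wstar s" "Wstar t" a' b'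
      proof
        fix g assume g: "g \<in> Lp_space M 1 \<inter> Lp_space M 2"
        have "Lp_norm M \<infinity> (W t (Wstar s g)) \<le> ennreal (C_inf * h powr (- \<mu>_inf) * d powr (- \<sigma>_inf)) * Lp_norm M 1 g"
          using i g unfolding d_def by blast
        also have "\<dots> \<le> ennreal a' * Lp_norm M 1 g"
          unfolding a'_def using ab by (intro mult_right_mono ennreal_leI) auto
        finally show "Lp_norm M \<infinity> (W t (Wstar s g)) \<le> ennreal a' * Lp_norm M 1 g" .
      next
        fix g assume g: "g \<in> Lp_space M 2"
        have "Lp_norm M 2 (W t (Wstar s g)) \<le> ennreal (C_2 * h powr (- \<mu>_2) * d powr (- \<sigma>_2)) * Lp_norm M 2 g"
          using ii g unfolding d_def by blast
        also have "\<dots> \<le> ennreal b' * Lp_norm M 2 g"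
          unfolding b'_def using ab by (intro mult_right_mono ennreal_leI) auto
        finally show "Lp_norm M 2 (W t (Wstar s g)) \<le> ennreal b' * Lp_norm M 2 g" .
      qed (use W adj ab' in auto)
      have "cmod (cinner (Wstar s \<phi>) (Wstar t \<psi>)) \<le> a' powr (1 - \<theta>) * b' powr \<theta>"
        by (rule interpolated_bound[OF ball \<theta> q(2)])
      also have "\<dots> = K * (h powr (- \<mu>_inf * (1 - \<theta>)) * h powr (- \<mu>_2 * \<theta>))
          * (d powr (- \<sigma>_inf * (1 - \<theta>)) * d powr (- \<sigma>_2 * \<theta>))"
        using ab h d by (simp add: a'_def b'_def K_def powr_mult powr_powr mult_ac)
      also have "h powr (- \<mu>_inf * (1 - \<theta>)) * h powr (- \<mu>_2 * \<theta>) = h powr (- \<mu>)"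
        unfolding powr_add[symmetric] by (simp add: \<mu>_def algebra_simps)
      also have "d powr (- \<sigma>_inf * (1 - \<theta>)) * d powr (- \<sigma>_2 * \<theta>) = d powr (- \<kappa>)"
        unfolding powr_add[symmetric] \<kappa>[symmetric] by (simp add: algebra_simps)
      finally show "cmod (cinner (Wstar s \<phi>) (Wstar t \<psi>)) \<le> K' * (h + \<bar>t - s\<bar>) powr (- \<kappa>)"
        by (simp add: K'_def d_def)
    qed (use W adj meas p q h K' \<kappa>0 in auto)
    have sqrt_h: "sqrt (h powr (- \<mu>)) = h powr (- (\<mu> / 2))"
      using h by (simp add: powr_half_sqrt[symmetric] powr_powr)
    have "ennreal_Lp_norm lebesgue r (\<lambda>t. Lp_norm M p (W t f)) \<le> ennreal (C * h powr (- (\<mu> / 2)) * norm f)"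
    proof (cases "r = \<infinity>")
      case True
      have "\<kappa> = 0" using True by (simp add: \<kappa>_def)
      from strichartz_infinity[OF this, of f] show ?thesis
        using True by (simp add: C_def K'_def real_sqrt_mult sqrt_h)
    next
      case False
      define R where "R = enn2real r"
      have rR: "r = ennreal R" using False by (simp add: R_def less_top[symmetric])
      have R: "2 < R" using assms(2) unfolding rR by (simp add: ennreal_less_iff[of 2, simplified])
      have "\<kappa> = 2 / R" using R unfolding \<kappa>_def rR
        by (simp add: divide_ennreal_def inverse_ennreal inverse_eq_divide)
      from strichartz_finite[OF R this, of "1 / (1 - 1 / R)" f] R show ?thesis
        unfolding rR[symmetric] using False
        by (simp add: C_def R_def[symmetric] K'_def real_sqrt_mult sqrt_h mult_ac)
    qed
    then show "ennreal_Lp_norm lebesgue r (\<lambda>t. Lp_norm M p (W t f))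
         \<le> ennreal (C * h powr (- (enn2real (1 / r) * ((\<mu>_inf - \<mu>_2) / (\<sigma>_inf - \<sigma>_2))
                                   + (\<sigma>_inf * \<mu>_2 - \<sigma>_2 * \<mu>_inf) / (2 * (\<sigma>_inf - \<sigma>_2))))
                    * norm f)"
      unfolding ex .
  qed
qed

end
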